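(* The variety $\mathcal{V}$ has the following properties. (i) $\mathcal{V}$ is locally finite, i.e. every finitely generated member of $\mathcal{V}$ is finite. (ii) For each positive integer $n$, $\mathcal{V}$ has a subdirectly irreducible member of cardinality $2^n+1$. (iii) For each infinite cardinal $k$, $\mathcal{V}$ has a subdirectly irreducible member of cardinality $k$. (iv) $\mathcal{V}$ is residually big, i.e. there is no cardinal bounding the cardinalities of all subdirectly irreducible members of $\mathcal{V}$. (v) $\mathcal{V}$ has a normal form system for its terms, given by the reduced representations: for every $n\in\mathbb{N}_0$ and every term $t(x_1,\ldots,x_n)$ there is exactly one reduced representation $t_1(x_1,\ldots,x_n)$ with $\mathcal{V}\models t\approx t_1$. Moreover, the word problem in $\mathcal{V}$ is solvable, i.e. there is an algorithm deciding, for any two given terms $t,u$ in the language $(+,\cdot,0,1)$, whether $\mathcal{V}\models t\approx u$.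
   Context: A semiring is an algebra $\mathbf{S}=(S,+,\cdot,0,1)$ of type $(2,2,0,0)$ such that $(S,+,0)$ is a commutative monoid, $(S,\cdot,1)$ is a monoid, $\cdot$ distributes over $+$ (on both sides), and $x0=0x=0$ for all $x\in S$. It is commutative if $\cdot$ is commutative and multiplicatively idempotent if $xx=x$ for all $x\in S$. $\mathcal{V}$ denotes the variety of all commutative multiplicatively idempotent semirings satisfying the identity $x+y+xyz\approx x+y$. $\mathcal{V}\models t\approx u$ means that the identity $t\approx u$ holds in every member of $\mathcal{V}$. For $n\in\mathbb{N}_0$ (the non-negative integers) put $N:=\{1,\ldots,n\}$. The linear order $\leq$ on $2^N$ is defined by: $I\leq J$ if $I=J$, or $|I|<|J|$, or $|I|=|J|=k$, $I=\{i_1<\cdots<i_k\}$, $J=\{j_1<\cdots<j_k\}$ and there exists $l\in\{1,\ldots,k\}$ with $(i_1,\ldots,i_{l-1})=(j_1,\ldots,j_{l-1})$ and $i_l<j_l$. Consider expressions of the form $\sum_{r=1}^m\prod_{s\in I_r}x_s$ with $m\in\mathbb{N}_0$, $I_1,\ldots,I_m\in 2^N$ and $I_1\leq\cdots\leq I_m$ (repetitions allowed), where the empty sum is $0$ and the empty product is $1$. Such an expression, determined by the sequence $(I_1,\ldots,I_m)$, is called a reduced representation if there do not exist mutually distinct $i,j,k\in\{1,\ldots,m\}$ with $I_i\cup I_j\subseteq I_k$. *)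

theory Defs
  imports "HOL-Algebra.Ring" "HOL-Library.Nat_Bijection" "HOL-Library.Countable_Set"
begin

unbundle cardinal_syntax

section \<open>The variety\<close>

locale V_semiring = semiring R for R (structure) +
  assumes m_comm: "\<lbrakk> x \<in> carrier R; y \<in> carrier R \<rbrakk> \<Longrightarrow> x \<otimes> y = y \<otimes> x"
    and m_idem: "x \<in> carrier R \<Longrightarrow> x \<otimes> x = x"
    and V_identity: "\<lbrakk> x \<in> carrier R; y \<in> carrier R; z \<in> carrier R \<rbrakk>
      \<Longrightarrow> x \<oplus> y \<oplus> x \<otimes> y \<otimes> z = x \<oplus> y"

definition subsemiring :: "'a set \<Rightarrow> 'a ring \<Rightarrow> bool" where
  "subsemiring H R \<longleftrightarrow> H \<subseteq> carrier R \<and> \<zero>\<^bsub>R\<^esub> \<in> H \<and> \<one>\<^bsub>R\<^esub> \<in> H \<and>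
     (\<forall>x\<in>H. \<forall>y\<in>H. x \<oplus>\<^bsub>R\<^esub> y \<in> H \<and> x \<otimes>\<^bsub>R\<^esub> y \<in> H)"

definition finitely_generated :: "'a ring \<Rightarrow> bool" where
  "finitely_generated R \<longleftrightarrow>
     (\<exists>G. finite G \<and> G \<subseteq> carrier R \<and> carrier R = \<Inter>{H. subsemiring H R \<and> G \<subseteq> H})"


section \<open>Subdirect irreducibility\<close>

text \<open>\<^const>\<open>ring_hom\<close> does not mention zero, whose preservation is not automatic
  for semirings.\<close>

definition semiring_hom :: "'a ring \<Rightarrow> 'b ring \<Rightarrow> ('a \<Rightarrow> 'b) set" where
  "semiring_hom R S = {h \<in> ring_hom R S. h \<zero>\<^bsub>R\<^esub> = \<zero>\<^bsub>S\<^esub>}"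

definition semiring_iso :: "'a ring \<Rightarrow> 'b ring \<Rightarrow> ('a \<Rightarrow> 'b) set" where
  "semiring_iso R S = {h \<in> semiring_hom R S. bij_betw h (carrier R) (carrier S)}"

definition product_semiring :: "'i set \<Rightarrow> ('i \<Rightarrow> 'b ring) \<Rightarrow> ('i \<Rightarrow> 'b) ring" where
  "product_semiring I A =
     \<lparr> carrier = (\<Pi>\<^sub>E i\<in>I. carrier (A i)),
       mult = (\<lambda>f g. \<lambda>i\<in>I. f i \<otimes>\<^bsub>A i\<^esub> g i),
       one = (\<lambda>i\<in>I. \<one>\<^bsub>A i\<^esub>),
       zero = (\<lambda>i\<in>I. \<zero>\<^bsub>A i\<^esub>),
       add = (\<lambda>f g. \<lambda>i\<in>I. f i \<oplus>\<^bsub>A i\<^esub> g i) \<rparr>"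

text \<open>The factors need not be assumed to be semirings: the last condition makes each of them a
  homomorphic image of \<open>R\<close>.\<close>

definition subdirect_embedding ::
    "'a ring \<Rightarrow> 'i set \<Rightarrow> ('i \<Rightarrow> 'b ring) \<Rightarrow> ('a \<Rightarrow> 'i \<Rightarrow> 'b) \<Rightarrow> bool" where
  "subdirect_embedding R I A f \<longleftrightarrow>
     f \<in> semiring_hom R (product_semiring I A) \<and> inj_on f (carrier R) \<and>
     (\<forall>i\<in>I. (\<lambda>x. f x i) ` carrier R = carrier (A i))"

text \<open>An algebra is subdirectly irreducible if each of its subdirect embeddings has a component
  that is an isomorphism. A definition cannot quantify over the types of the index set and of the
  factors. They are fixed here so that there is room for one factor per congruence and for every
  homomorphic image of \<open>R\<close>; the two lemmas at the end of this section show that nothing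
  is lost: all types of indices and factors are covered, and the notion coincides with the
  existence of a least nontrivial congruence. Because of the empty index set, the
  one-element algebra is not subdirectly irreducible.\<close>

definition subdirectly_irreducible :: "'a ring \<Rightarrow> bool" where
  "subdirectly_irreducible R \<longleftrightarrow>
     (\<forall>(I :: ('a \<times> 'a) set set) (A :: ('a \<times> 'a) set \<Rightarrow> 'a ring) f.
        subdirect_embedding R I A f \<longrightarrow> (\<exists>i\<in>I. (\<lambda>x. f x i) \<in> semiring_iso R (A i)))"

definition congruence :: "'a ring \<Rightarrow> ('a \<times> 'a) set \<Rightarrow> bool" where
  "congruence R \<theta> \<longleftrightarrow> equiv (carrier R) \<theta> \<and>
     (\<forall>a b c d. (a, b) \<in> \<theta> \<longrightarrow> (c, d) \<in> \<theta> \<longrightarrow>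
        (a \<oplus>\<^bsub>R\<^esub> c, b \<oplus>\<^bsub>R\<^esub> d) \<in> \<theta> \<and> (a \<otimes>\<^bsub>R\<^esub> c, b \<otimes>\<^bsub>R\<^esub> d) \<in> \<theta>)"

definition monolith :: "'a ring \<Rightarrow> ('a \<times> 'a) set \<Rightarrow> bool" where
  "monolith R \<theta> \<longleftrightarrow> congruence R \<theta> \<and> \<theta> \<noteq> Id_on (carrier R) \<and>
     (\<forall>\<psi>. congruence R \<psi> \<longrightarrow> \<psi> \<noteq> Id_on (carrier R) \<longrightarrow> \<theta> \<subseteq> \<psi>)"

lemma monolith_imp_iso_component:
  fixes R :: "'a ring" and I :: "'i set" and A :: "'i \<Rightarrow> 'b ring"
  assumes R: "semiring R" and mono: "monolith R \<theta>" and f: "subdirect_embedding R I A f"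
  shows "\<exists>i\<in>I. (\<lambda>x. f x i) \<in> semiring_iso R (A i)"
proof -
  interpret semiring R by (fact R)
  have hom: "f \<in> ring_hom R (product_semiring I A)" "f \<zero>\<^bsub>R\<^esub> = (\<lambda>i\<in>I. \<zero>\<^bsub>A i\<^esub>)"
    and inj: "inj_on f (carrier R)"
    and surj: "\<And>i. i \<in> I \<Longrightarrow> (\<lambda>x. f x i) ` carrier R = carrier (A i)"
    using f by (auto simp: subdirect_embedding_def semiring_hom_def product_semiring_def)
  have comp: "(\<lambda>x. f x i) \<in> semiring_hom R (A i)" if i: "i \<in> I" for i
    using hom i unfolding semiring_hom_def ring_hom_def product_semiring_def
    by (auto simp: PiE_iff Pi_iff)
  define K where "K i = {(x, y). x \<in> carrier R \<and> y \<in> carrier R \<and> f x i = f y i}" for i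
  have K: "congruence R (K i)" if i: "i \<in> I" for i
    unfolding congruence_def
  proof (intro conjI allI impI)
    show "equiv (carrier R) (K i)"
      unfolding K_def by (rule equivI) (auto simp: refl_on_def sym_def trans_def)
  next
    fix a b c d assume "(a, b) \<in> K i" "(c, d) \<in> K i"
    then show "(a \<oplus>\<^bsub>R\<^esub> c, b \<oplus>\<^bsub>R\<^esub> d) \<in> K i" and "(a \<otimes>\<^bsub>R\<^esub> c, b \<otimes>\<^bsub>R\<^esub> d) \<in> K i"
      using comp[OF i] by (auto simp: K_def semiring_hom_def ring_hom_def)
  qed
  have ext: "f x \<in> extensional I" if "x \<in> carrier R" for x
    using hom(1) that by (auto simp: ring_hom_def product_semiring_def PiE_def Pi_def)
  have \<theta>: "congruence R \<theta>" "\<theta> \<noteq> Id_on (carrier R)"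
    using mono by (auto simp: monolith_def)
  then have eq: "equiv (carrier R) \<theta>"
    by (simp add: congruence_def)
  have "\<exists>i\<in>I. K i = Id_on (carrier R)"
  proof (rule ccontr)
    assume "\<not> ?thesis"
    then have sub: "\<theta> \<subseteq> K i" if "i \<in> I" for i
      using that mono K by (auto simp: monolith_def)
    have "x = y" if xy: "(x, y) \<in> \<theta>" for x y
    proof -
      have car: "x \<in> carrier R" "y \<in> carrier R"
        using xy eq by (auto dest: equivE equiv_type)
      have "f x = f y"
        by (rule extensionalityI[OF ext[OF car(1)] ext[OF car(2)]])
          (use sub xy in \<open>auto simp: K_def\<close>)
      then show ?thesis using inj car by (auto dest: inj_onD)
    qed
    moreover have "(x, x) \<in> \<theta>" if "x \<in> carrier R" for x
      using eq that by (auto simp: equiv_def refl_on_def)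
    ultimately have "\<theta> = Id_on (carrier R)"
      using equiv_type[OF eq] by (auto simp: Id_on_def)
    with \<theta>(2) show False ..
  qed
  then obtain i where i: "i \<in> I" and Ki: "K i = Id_on (carrier R)" by auto
  have "inj_on (\<lambda>x. f x i) (carrier R)"
  proof (rule inj_onI)
    fix x y assume "x \<in> carrier R" "y \<in> carrier R" "f x i = f y i"
    then have "(x, y) \<in> K i" by (simp add: K_def)
    then show "x = y" by (auto simp: Ki)
  qed
  then have "(\<lambda>x. f x i) \<in> semiring_iso R (A i)"
    using comp[OF i] surj[OF i] by (simp add: semiring_iso_def bij_betw_def)
  with i show ?thesis by auto
qed

lemma subdirectly_irreducible_iff_monolith:
  assumes R: "semiring R"
  shows "subdirectly_irreducible R \<longleftrightarrow> (\<exists>\<theta>. monolith R \<theta>)"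
proof
  assume "\<exists>\<theta>. monolith R \<theta>"
  then show "subdirectly_irreducible R"
    unfolding subdirectly_irreducible_def using monolith_imp_iso_component[OF R] by blast
next
  assume si: "subdirectly_irreducible R"
  interpret semiring R by (fact R)
  let ?C = "carrier R"
  show "\<exists>\<theta>. monolith R \<theta>"
  proof (rule ccontr)
    assume no: "\<nexists>\<theta>. monolith R \<theta>"
    define I where "I = {\<psi>. congruence R \<psi> \<and> \<psi> \<noteq> Id_on ?C}"
    define r where "r \<psi> x = (SOME y. (x, y) \<in> \<psi>)" for \<psi> :: "('a \<times> 'a) set" and x
    define A where "A \<psi> = \<lparr> carrier = r \<psi> ` ?C, mult = (\<lambda>x y. r \<psi> (x \<otimes>\<^bsub>R\<^esub> y)),
      one = r \<psi> \<one>\<^bsub>R\<^esub>, zero = r \<psi> \<zero>\<^bsub>R\<^esub>, add = (\<lambda>x y. r \<psi> (x \<oplus>\<^bsub>R\<^esub> y)) \<rparr>" for \<psi>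
    define f where "f x = (\<lambda>\<psi>\<in>I. r \<psi> x)" for x
    have eqI: "equiv ?C \<psi>" if "\<psi> \<in> I" for \<psi>
      using that by (auto simp: I_def congruence_def)
    have r_rel: "(x, r \<psi> x) \<in> \<psi>" if "\<psi> \<in> I" "x \<in> ?C" for \<psi> x
    proof -
      have "(x, x) \<in> \<psi>" using eqI[OF that(1)] that(2) by (auto simp: equiv_def refl_on_def)
      then show ?thesis unfolding r_def by (rule someI)
    qed
    have r_eq: "r \<psi> x = r \<psi> y" if "\<psi> \<in> I" "(x, y) \<in> \<psi>" for \<psi> x y
    proof -
      have "(x, z) \<in> \<psi> \<longleftrightarrow> (y, z) \<in> \<psi>" for z
        using eqI[OF that(1)] that(2) by (meson equivE symD transD)
      then show ?thesis by (simp add: r_def)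
    qed
    have r_ops: "r \<psi> (x \<oplus>\<^bsub>R\<^esub> y) = r \<psi> (r \<psi> x \<oplus>\<^bsub>R\<^esub> r \<psi> y)"
        "r \<psi> (x \<otimes>\<^bsub>R\<^esub> y) = r \<psi> (r \<psi> x \<otimes>\<^bsub>R\<^esub> r \<psi> y)"
      if "\<psi> \<in> I" "x \<in> ?C" "y \<in> ?C" for \<psi> x y
    proof -
      have "congruence R \<psi>" using that(1) by (simp add: I_def)
      then have "(x \<oplus>\<^bsub>R\<^esub> y, r \<psi> x \<oplus>\<^bsub>R\<^esub> r \<psi> y) \<in> \<psi>" "(x \<otimes>\<^bsub>R\<^esub> y, r \<psi> x \<otimes>\<^bsub>R\<^esub> r \<psi> y) \<in> \<psi>"
        using r_rel that by (auto simp: congruence_def)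
      then show "r \<psi> (x \<oplus>\<^bsub>R\<^esub> y) = r \<psi> (r \<psi> x \<oplus>\<^bsub>R\<^esub> r \<psi> y)"
        "r \<psi> (x \<otimes>\<^bsub>R\<^esub> y) = r \<psi> (r \<psi> x \<otimes>\<^bsub>R\<^esub> r \<psi> y)"
        using r_eq[OF that(1)] by auto
    qed
    have inj: "inj_on f ?C"
    proof (rule inj_onI, rule ccontr)
      fix x y assume xy: "x \<in> ?C" "y \<in> ?C" "f x = f y" "x \<noteq> y"
      define M where "M = (?C \<times> ?C) \<inter> \<Inter>I"
      have xyI: "(x, y) \<in> \<psi>" if "\<psi> \<in> I" for \<psi>
      proof -
        have "r \<psi> x = r \<psi> y" using fun_cong[OF xy(3), of \<psi>] that by (simp add: f_def)
        then show ?thesis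
          using r_rel[OF that xy(1)] r_rel[OF that xy(2)] eqI[OF that] by (metis equivE symD transD)
      qed
      have "congruence R M"
        unfolding congruence_def
      proof (intro conjI allI impI)
        have "refl_on ?C M"
          using eqI by (auto simp: M_def refl_on_def equiv_def)
        moreover have "sym M"
          using eqI unfolding M_def sym_def by (blast dest: equivE symD)
        moreover have "trans M"
          using eqI unfolding M_def trans_def by (blast dest: equivE transD)
        ultimately show "equiv ?C M"
          by (auto intro!: equivI simp: M_def)
      next
        fix a b c d assume ab: "(a, b) \<in> M" "(c, d) \<in> M"
        have "(a \<oplus>\<^bsub>R\<^esub> c, b \<oplus>\<^bsub>R\<^esub> d) \<in> \<psi> \<and> (a \<otimes>\<^bsub>R\<^esub> c, b \<otimes>\<^bsub>R\<^esub> d) \<in> \<psi>" if "\<psi> \<in> I" for \<psi>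
        proof -
          have "congruence R \<psi>" "(a, b) \<in> \<psi>" "(c, d) \<in> \<psi>"
            using that ab by (auto simp: I_def M_def)
          then show ?thesis by (auto simp: congruence_def)
        qed
        with ab show "(a \<oplus>\<^bsub>R\<^esub> c, b \<oplus>\<^bsub>R\<^esub> d) \<in> M" "(a \<otimes>\<^bsub>R\<^esub> c, b \<otimes>\<^bsub>R\<^esub> d) \<in> M"
          by (auto simp: M_def)
      qed
      moreover have "(x, y) \<in> M" using xy xyI by (auto simp: M_def)
      then have "M \<noteq> Id_on ?C" using xy(4) by auto
      ultimately have "monolith R M"
        by (auto simp: monolith_def M_def I_def)
      with no show False by blast
    qed
    have "subdirect_embedding R I A f"
      unfolding subdirect_embedding_def
    proof (intro conjI ballI inj)
      show "f \<in> semiring_hom R (product_semiring I A)"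
        unfolding semiring_hom_def ring_hom_def product_semiring_def
        by (auto simp: f_def A_def PiE_iff intro!: restrict_ext r_ops)
      show "(\<lambda>x. f x i) ` ?C = carrier (A i)" if "i \<in> I" for i
        using that by (simp add: f_def A_def)
    qed
    with si obtain \<psi> where \<psi>: "\<psi> \<in> I" "(\<lambda>x. f x \<psi>) \<in> semiring_iso R (A \<psi>)"
      unfolding subdirectly_irreducible_def by blast
    then have inj\<psi>: "inj_on (r \<psi>) ?C"
      by (simp add: semiring_iso_def bij_betw_def f_def)
    have "\<psi> = Id_on ?C"
    proof
      show "\<psi> \<subseteq> Id_on ?C"
      proof
        fix p assume p: "p \<in> \<psi>"
        obtain x y where [simp]: "p = (x, y)" by (cases p)
        have "x \<in> ?C" "y \<in> ?C" using p equiv_type[OF eqI[OF \<psi>(1)]] by auto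
        moreover have "r \<psi> x = r \<psi> y" using p r_eq[OF \<psi>(1)] by simp
        ultimately show "p \<in> Id_on ?C" using inj\<psi> by (auto dest: inj_onD)
      qed
      show "Id_on ?C \<subseteq> \<psi>"
        using eqI[OF \<psi>(1)] by (auto simp: equiv_def refl_on_def)
    qed
    with \<psi>(1) show False by (simp add: I_def)
  qed
qed

lemma subdirectly_irreducible_all_types:
  fixes R :: "'a ring" and I :: "'i set" and A :: "'i \<Rightarrow> 'b ring"
  assumes "semiring R" and "subdirectly_irreducible R" and "subdirect_embedding R I A f"
  shows "\<exists>i\<in>I. (\<lambda>x. f x i) \<in> semiring_iso R (A i)"
  using assms monolith_imp_iso_component subdirectly_irreducible_iff_monolith by blast


section \<open>Terms and identities\<close>

text \<open>\<open>TVar i\<close> is the variable \<open>x\<^sub>i\<close>; a term \<open>t(x\<^sub>1,\<dots>,x\<^sub>n)\<close> is one with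
  \<open>vars t \<subseteq> {1..n}\<close>.\<close>

datatype sterm =
    TVar nat
  | TZero
  | TOne
  | TAdd sterm sterm
  | TMul sterm sterm

instance sterm :: countable
  by countable_datatype

primrec vars :: "sterm \<Rightarrow> nat set" where
  "vars (TVar i) = {i}"
| "vars TZero = {}"
| "vars TOne = {}"
| "vars (TAdd t u) = vars t \<union> vars u"
| "vars (TMul t u) = vars t \<union> vars u"

primrec eval_term :: "'a ring \<Rightarrow> (nat \<Rightarrow> 'a) \<Rightarrow> sterm \<Rightarrow> 'a" where
  "eval_term R v (TVar i) = v i"
| "eval_term R v TZero = \<zero>\<^bsub>R\<^esub>"
| "eval_term R v TOne = \<one>\<^bsub>R\<^esub>"
| "eval_term R v (TAdd t u) = eval_term R v t \<oplus>\<^bsub>R\<^esub> eval_term R v u"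
| "eval_term R v (TMul t u) = eval_term R v t \<otimes>\<^bsub>R\<^esub> eval_term R v u"

text \<open>Validity of an identity in every member of the variety. A definition cannot quantify over
  carrier types; members on the type \<^typ>\<open>nat\<close> suffice, since a failing identity already fails
  in a countable subalgebra. This is the content of the lemma that follows.\<close>

definition V_models :: "sterm \<Rightarrow> sterm \<Rightarrow> bool" where
  "V_models t u \<longleftrightarrow>
     (\<forall>(R :: nat ring) v. V_semiring R \<longrightarrow> (\<forall>i. v i \<in> carrier R) \<longrightarrow>
        eval_term R v t = eval_term R v u)"

lemma V_models_all_types:
  fixes R :: "'a ring"
  assumes tu: "V_models t u" and R: "V_semiring R" and v: "\<And>i. v i \<in> carrier R"
  shows "eval_term R v t = eval_term R v u"
proof -
  interpret V_semiring R by (fact R)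
  define S where "S = range (eval_term R v)"
  define e where "e = to_nat_on S"
  define d where "d = inv_into S e"
  have "countable S" by (simp add: S_def)
  then have inj: "inj_on e S" by (simp add: e_def inj_on_to_nat_on)
  have de: "d (e x) = x" if "x \<in> S" for x
    using that inj by (simp add: d_def)
  have ev: "eval_term R v s \<in> carrier R" for s
    by (induction s) (simp_all add: v)
  have SC: "x \<in> carrier R" if "x \<in> S" for x
    using that ev by (auto simp: S_def)
  have S0: "\<zero>\<^bsub>R\<^esub> \<in> S" unfolding S_def by (rule range_eqI[of _ _ TZero]) simp
  have S1: "\<one>\<^bsub>R\<^esub> \<in> S" unfolding S_def by (rule range_eqI[of _ _ TOne]) simp
  have Sadd: "x \<oplus>\<^bsub>R\<^esub> y \<in> S" if xy: "x \<in> S" "y \<in> S" for x y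
  proof -
    obtain a b where "x = eval_term R v a" "y = eval_term R v b"
      using xy by (auto simp: S_def)
    then show ?thesis unfolding S_def by (intro range_eqI[of _ _ "TAdd a b"]) simp
  qed
  have Smul: "x \<otimes>\<^bsub>R\<^esub> y \<in> S" if xy: "x \<in> S" "y \<in> S" for x y
  proof -
    obtain a b where "x = eval_term R v a" "y = eval_term R v b"
      using xy by (auto simp: S_def)
    then show ?thesis unfolding S_def by (intro range_eqI[of _ _ "TMul a b"]) simp
  qed
  define N :: "nat ring" where "N = \<lparr> carrier = e ` S, mult = (\<lambda>x y. e (d x \<otimes>\<^bsub>R\<^esub> d y)),
     one = e \<one>\<^bsub>R\<^esub>, zero = e \<zero>\<^bsub>R\<^esub>, add = (\<lambda>x y. e (d x \<oplus>\<^bsub>R\<^esub> d y)) \<rparr>"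
  have V_identity': "x \<oplus>\<^bsub>R\<^esub> (y \<oplus>\<^bsub>R\<^esub> x \<otimes>\<^bsub>R\<^esub> (y \<otimes>\<^bsub>R\<^esub> z)) = x \<oplus>\<^bsub>R\<^esub> y"
    if "x \<in> carrier R" "y \<in> carrier R" "z \<in> carrier R" for x y z
    using V_identity[OF that] that by (simp add: a_assoc m_assoc)
  note simps = N_def de S0 S1 Sadd Smul SC
  have "V_semiring N"
    by unfold_locales
      (auto simp: simps a_assoc m_assoc l_distr r_distr m_idem V_identity'
         intro!: arg_cong[of _ _ e] intro: a_comm m_comm)
  moreover have "e (v i) \<in> carrier N" for i
    unfolding N_def S_def by (auto intro!: imageI range_eqI[of _ _ "TVar i"])
  ultimately have "eval_term N (\<lambda>i. e (v i)) t = eval_term N (\<lambda>i. e (v i)) u"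
    using tu by (auto simp: V_models_def)
  moreover have "eval_term N (\<lambda>i. e (v i)) s = e (eval_term R v s)" for s
    by (induction s) (simp_all add: N_def de S_def)
  ultimately have "e (eval_term R v t) = e (eval_term R v u)" by simp
  then show ?thesis using inj by (auto simp: S_def dest: inj_onD)
qed


section \<open>Reduced representations\<close>

definition subset_le :: "nat set \<Rightarrow> nat set \<Rightarrow> bool" where
  "subset_le I J \<longleftrightarrow> I = J \<or> card I < card J \<or>
     (card I = card J \<and>
       (let is = sorted_list_of_set I; js = sorted_list_of_set J
        in \<exists>l < card I. take l is = take l js \<and> is ! l < js ! l))"

fun sum_term :: "sterm list \<Rightarrow> sterm" where
  "sum_term [] = TZero"
| "sum_term [t] = t"
| "sum_term (t # ts) = TAdd t (sum_term ts)"

fun prod_term :: "sterm list \<Rightarrow> sterm" where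
  "prod_term [] = TOne"
| "prod_term [t] = t"
| "prod_term (t # ts) = TMul t (prod_term ts)"

definition rep_term :: "nat set list \<Rightarrow> sterm" where
  "rep_term Is = sum_term (map (\<lambda>I. prod_term (map TVar (sorted_list_of_set I))) Is)"

definition reduced_rep :: "nat \<Rightarrow> nat set list \<Rightarrow> bool" where
  "reduced_rep n Is \<longleftrightarrow>
     (\<forall>I \<in> set Is. I \<subseteq> {1..n}) \<and> sorted_wrt subset_le Is \<and>
     \<not> (\<exists>i j k. i < length Is \<and> j < length Is \<and> k < length Is \<and>
          i \<noteq> j \<and> i \<noteq> k \<and> j \<noteq> k \<and> Is ! i \<union> Is ! j \<subseteq> Is ! k)"


section \<open>Algorithms\<close>

text \<open>The total recursive functions: \<open>recursive k f\<close> says that \<open>f\<close>, restricted to lists of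
  length \<open>k\<close>, is a recursive function of \<open>k\<close> arguments. Minimization is applied to regular
  functions only, so all functions are total. Values on lists of other lengths are irrelevant,
  hence the rule \<open>ext\<close>.\<close>

inductive recursive :: "nat \<Rightarrow> (nat list \<Rightarrow> nat) \<Rightarrow> bool" where
  zero: "recursive k (\<lambda>xs. 0)"
| succ: "recursive 1 (\<lambda>xs. Suc (xs ! 0))"
| proj: "i < k \<Longrightarrow> recursive k (\<lambda>xs. xs ! i)"
| comp: "\<lbrakk> recursive (length gs) f; \<forall>g \<in> set gs. recursive k g \<rbrakk>
    \<Longrightarrow> recursive k (\<lambda>xs. f (map (\<lambda>g. g xs) gs))"
| prim: "\<lbrakk> recursive k f; recursive (Suc (Suc k)) g \<rbrakk>
    \<Longrightarrow> recursive (Suc k) (\<lambda>xs. rec_nat (f (tl xs)) (\<lambda>y r. g (y # r # tl xs)) (hd xs))"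
| mini: "\<lbrakk> recursive (Suc k) f; \<forall>xs. length xs = k \<longrightarrow> (\<exists>y. f (y # xs) = 0) \<rbrakk>
    \<Longrightarrow> recursive k (\<lambda>xs. LEAST y. f (y # xs) = 0)"
| ext: "\<lbrakk> recursive k f; \<forall>xs. length xs = k \<longrightarrow> g xs = f xs \<rbrakk> \<Longrightarrow> recursive k g"

primrec code :: "sterm \<Rightarrow> nat" where
  "code TZero = prod_encode (0, 0)"
| "code TOne = prod_encode (0, 1)"
| "code (TVar i) = prod_encode (1, i)"
| "code (TAdd t u) = prod_encode (2, prod_encode (code t, code u))"
| "code (TMul t u) = prod_encode (3, prod_encode (code t, code u))"

lemma code_inject: "code t = code u \<longleftrightarrow> t = u"
proof (induction t arbitrary: u)
  case (TVar i)
  then show ?case by (cases u) (auto simp: inj_eq[OF inj_prod_encode])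
next
  case TZero
  then show ?case by (cases u) (auto simp: inj_eq[OF inj_prod_encode])
next
  case TOne
  then show ?case by (cases u) (auto simp: inj_eq[OF inj_prod_encode])
next
  case (TAdd t1 t2)
  then show ?case by (cases u) (auto simp: inj_eq[OF inj_prod_encode])
next
  case (TMul t1 t2)
  then show ?case by (cases u) (auto simp: inj_eq[OF inj_prod_encode])
qed

definition algorithmically_decidable :: "(sterm \<Rightarrow> sterm \<Rightarrow> bool) \<Rightarrow> bool" where
  "algorithmically_decidable P \<longleftrightarrow>
     (\<exists>f. recursive 2 f \<and> (\<forall>t u. f [code t, code u] = (if P t u then 1 else 0)))"

end

theory Submission
  imports "HOL-Library.Multiset" "HOL-Library.List_Lenlexorder" Defs
begin

text \<open>In a member of the variety every term is a finite sum of monomials, that is, of products over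
  finite sets of variables. By \<open>x + y + xyz = x + y\<close> a monomial \<open>K\<close> can be dropped as soon as two
  others lie below it, which leads to a reduced representation. The set \<open>{0, 1, 2}\<close> with
  addition and multiplication truncated at \<open>2\<close> is a member of the variety; there, under the 0-1
  valuation of a set \<open>K\<close> of variables, a sum of monomials has as value the truncated number of its
  monomials contained in \<open>K\<close>. By induction on the size of \<open>K\<close> these numbers determine the
  multiplicities in a reduced representation. Hence reduced representations are unique, and an
  identity holds in the variety iff it holds in \<open>{0, 1, 2}\<close> under all 0-1 valuations, which yields
  local finiteness and decidability.

  If \<open>L\<close> is a distributive lattice with \<open>0\<close> and greatest element \<open>e\<close>, then \<open>L\<close> with a new unit
  \<open>1\<close> and \<open>1 + c = e\<close> for \<open>c \<noteq> 0\<close> belongs to the variety. If \<open>L\<close> is disjunctive, i.e. for any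
  \<open>a \<noteq> b\<close> some \<open>z\<close> meets exactly one of them in \<open>0\<close>, then any congruence that identifies
  \<open>a\<close> and \<open>b\<close> identifies \<open>0\<close> with some \<open>d \<noteq> 0\<close> and, adding \<open>1\<close>, also \<open>1\<close> with \<open>e\<close>.
  So there is a least nontrivial congruence. Such \<open>L\<close> exist in the required sizes:
  take the finite subsets of \<open>X\<close> and \<open>X\<close> itself.\<close>


section \<open>Sums of monomials\<close>

text \<open>With multiplication commutative, \<open>finprod\<close> over a set of variables is
  available; it serves as the monomial of that set.\<close>

sublocale V_semiring \<subseteq> mult: comm_monoid R
  by unfold_locales (rule m_comm)

text \<open>Expansion by distributivity. A list keeps multiplicities, which matter: addition need
  not be idempotent, as 1 + 1 = 2 in {0, 1, 2} shows.\<close>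

primrec monomials :: "sterm \<Rightarrow> nat set list" where
  "monomials (TVar i) = [{i}]"
| "monomials TZero = []"
| "monomials TOne = [{}]"
| "monomials (TAdd t u) = monomials t @ monomials u"
| "monomials (TMul t u) = concat (map (\<lambda>I. map ((\<union>) I) (monomials u)) (monomials t))"

lemma finite_vars: "finite (vars t)"
  by (induction t) auto

lemma monomials_subset: "I \<in> set (monomials t) \<Longrightarrow> I \<subseteq> vars t"
  by (induction t arbitrary: I) fastforce+

lemma finite_monomials: "I \<in> set (monomials t) \<Longrightarrow> finite I"
  using finite_subset[OF monomials_subset finite_vars] .

locale V_valuation = V_semiring R for R :: "'a ring" (structure) +
  fixes v :: "nat \<Rightarrow> 'a"
  assumes v [simp]: "v i \<in> carrier R"
begin

abbreviation monom :: "nat set \<Rightarrow> 'a" where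
  "monom I \<equiv> finprod R v I"

definition monom_sum :: "nat set list \<Rightarrow> 'a" where
  "monom_sum Is = foldr (\<lambda>I s. monom I \<oplus> s) Is \<zero>"

lemma monom_sum_Nil [simp]: "monom_sum [] = \<zero>"
  and monom_sum_Cons [simp]: "monom_sum (I # Is) = monom I \<oplus> monom_sum Is"
  by (simp_all add: monom_sum_def)

lemma monom_closed [simp]: "monom I \<in> carrier R"
  by (rule mult.finprod_closed) simp

text \<open>Multiplicative idempotence absorbs a repeated factor. This is why monomials may be
  indexed by sets and why \<open>monom_Un\<close> does without disjointness.\<close>

lemma monom_insert:
  assumes "finite I"
  shows "monom (insert i I) = v i \<otimes> monom I"
proof (cases "i \<in> I")
  case True
  then obtain J where J: "I = insert i J" "i \<notin> J"
    by (meson Set.set_insert)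
  with assms have "monom I = v i \<otimes> monom J"
    by auto
  then have "v i \<otimes> monom I = (v i \<otimes> v i) \<otimes> monom J"
    by (simp add: m_assoc)
  with True J \<open>monom I = _\<close> show ?thesis
    by (simp add: insert_absorb m_idem)
qed (use assms in simp)

lemma monom_Un:
  assumes "finite I" "finite J"
  shows "monom (I \<union> J) = monom I \<otimes> monom J"
  using assms(1) by induction (simp_all add: monom_insert assms(2) m_assoc)

lemma monom_sum_closed [simp]: "monom_sum Is \<in> carrier R"
  by (induction Is) simp_all

lemma monom_sum_append: "monom_sum (Is @ Js) = monom_sum Is \<oplus> monom_sum Js"
  by (induction Is) (simp_all add: a_assoc)

lemma monom_sum_mset_cong: "mset Is = mset Js \<Longrightarrow> monom_sum Is = monom_sum Js"
proof (induction Is arbitrary: Js)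
  case (Cons I Is)
  then have "I \<in> set Js"
    by (metis list.set_intros(1) set_mset_mset)
  then obtain Js1 Js2 where Js: "Js = Js1 @ I # Js2"
    by (auto simp: in_set_conv_decomp)
  with Cons have "monom_sum Is = monom_sum (Js1 @ Js2)"
    by simp
  then show ?case
    by (simp add: Js monom_sum_append a_lcomm)
qed simp

lemma monom_sum_mult:
  assumes "finite I" "\<forall>J\<in>set Js. finite J"
  shows "monom_sum (map ((\<union>) I) Js) = monom I \<otimes> monom_sum Js"
  using assms(2) by (induction Js) (simp_all add: assms(1) monom_Un r_distr)

lemma monom_sum_mult_list:
  assumes "\<forall>I\<in>set Is. finite I" "\<forall>J\<in>set Js. finite J"
  shows "monom_sum (concat (map (\<lambda>I. map ((\<union>) I) Js) Is)) = monom_sum Is \<otimes> monom_sum Js"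
  using assms(1)
  by (induction Is) (simp_all add: monom_sum_append monom_sum_mult assms(2) l_distr)

text \<open>Since K is the union of I, J and K, its monomial is a product xyz with x and y the
  monomials of I and J. The defining identity of the variety then drops it.\<close>

lemma monom_absorb:
  assumes "finite K" "I \<union> J \<subseteq> K"
  shows "monom I \<oplus> monom J \<oplus> monom K = monom I \<oplus> monom J"
proof -
  have "K = I \<union> (J \<union> K)" "finite I" "finite J"
    using assms finite_subset by auto
  then have "monom K = monom I \<otimes> monom J \<otimes> monom K"
    by (metis assms(1) finite_UnI monom_Un monom_closed m_assoc)
  then show ?thesis
    by (metis V_identity monom_closed)
qed

lemma eval_term_closed: "eval_term R v t \<in> carrier R"
  by (induction t) simp_all

lemma eval_prod_term:
  "eval_term R v (prod_term (map TVar is)) = foldr (\<lambda>i p. v i \<otimes> p) is \<one>"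
  by (induction "is" rule: induct_list012) simp_all

lemma eval_monomial_term:
  assumes "finite I"
  shows "eval_term R v (prod_term (map TVar (sorted_list_of_set I))) = monom I"
proof -
  have "foldr (\<lambda>i p. v i \<otimes> p) is \<one> = monom (set is)" if "distinct is" for "is"
    using that by (induction "is") simp_all
  from this[of "sorted_list_of_set I"] show ?thesis
    by (simp add: eval_prod_term assms)
qed

lemma eval_rep_term:
  assumes "\<forall>I\<in>set Is. finite I"
  shows "eval_term R v (rep_term Is) = monom_sum Is"
  using assms unfolding rep_term_def
  by (induction Is rule: induct_list012) (simp_all add: eval_monomial_term)

lemma eval_monomials: "eval_term R v t = monom_sum (monomials t)"
  by (induction t)
    (simp_all add: monom_sum_append monom_sum_mult_list finite_monomials)

end


section \<open>Reduction of sums of monomials\<close>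

definition count_below :: "nat set \<Rightarrow> nat set list \<Rightarrow> nat" where
  "count_below K Is = length (filter (\<lambda>I. I \<subseteq> K) Is)"

lemma count_below_mset: "mset Is = mset Js \<Longrightarrow> count_below K Is = count_below K Js"
  unfolding count_below_def by (metis mset_filter size_mset)

text \<open>A forbidden triple with third index k needs two further positions carrying subsets of
  \<open>Is ! k\<close>. Position k is itself among those counted, so the bound is 2 and not
  1.\<close>

lemma no_triple_iff:
  "\<not> (\<exists>i j k. i < length Is \<and> j < length Is \<and> k < length Is \<and>
          i \<noteq> j \<and> i \<noteq> k \<and> j \<noteq> k \<and> Is ! i \<union> Is ! j \<subseteq> Is ! k) \<longleftrightarrow>
   (\<forall>K\<in>set Is. count_below K Is \<le> 2)" (is "\<not> ?T \<longleftrightarrow> _")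
proof -
  have "(\<exists>i j. i < length Is \<and> j < length Is \<and> i \<noteq> j \<and> i \<noteq> k \<and> j \<noteq> k \<and> Is ! i \<union> Is ! j \<subseteq> Is ! k)
      \<longleftrightarrow> \<not> count_below (Is ! k) Is \<le> 2" (is "?L \<longleftrightarrow> ?R") if k: "k < length Is" for k
  proof -
    define S where "S = {i. i < length Is \<and> Is ! i \<subseteq> Is ! k}"
    have [simp]: "finite S" "k \<in> S" using k by (auto simp: S_def)
    have "count_below (Is ! k) Is = card S"
      by (simp add: count_below_def S_def length_filter_conv_card)
    moreover have "card S = Suc (card (S - {k}))"
      by (rule card.remove) auto
    moreover have "card (S - {k}) \<le> 1 \<longleftrightarrow> (\<forall>i\<in>S - {k}. \<forall>j\<in>S - {k}. i = j)"
      by (simp add: card_le_Suc0_iff_eq del: card_Diff_insert card_Diff_singleton)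
    ultimately have "?R \<longleftrightarrow> \<not> (\<forall>i\<in>S - {k}. \<forall>j\<in>S - {k}. i = j)"
      by linarith
    then show ?thesis unfolding S_def by auto
  qed
  then have "?T \<longleftrightarrow> (\<exists>k<length Is. \<not> count_below (Is ! k) Is \<le> 2)"
    by blast
  then show ?thesis by (auto simp: all_set_conv_all_nth)
qed

text \<open>The order on sets is the length-lexicographic order of their increasing enumerations.
  This makes sorting and the uniqueness of sorted lists applicable.\<close>

lemma subset_le_iff:
  assumes "finite I" "finite J"
  shows "subset_le I J \<longleftrightarrow> sorted_list_of_set I \<le> sorted_list_of_set J"
proof -
  define xs ys where "xs = sorted_list_of_set I" and "ys = sorted_list_of_set J"
  have len: "length xs = card I" "length ys = card J"
    by (simp_all add: xs_def ys_def)
  have eq: "I = J \<longleftrightarrow> xs = ys"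
    unfolding xs_def ys_def using assms by (metis set_sorted_list_of_set)
  have "(xs, ys) \<in> lex {(u, v). u < v} \<longleftrightarrow> (\<exists>l<length xs. take l xs = take l ys \<and> xs ! l < ys ! l)"
    if "length xs = length ys"
  proof -
    have "(xs, ys) \<in> lex {(u, v). u < v} \<longleftrightarrow> (xs, ys) \<in> lexord {(u, v). u < v}"
      using that by (simp add: lexord_lex)
    also have "\<dots> \<longleftrightarrow> (\<exists>l<length xs. take l xs = take l ys \<and> xs ! l < ys ! l)"
      using that by (auto simp: lexord_take_index_conv)
    finally show ?thesis .
  qed
  then show ?thesis
    unfolding subset_le_def Let_def list_le_def list_less_def lenlex_conv
    by (fold xs_def ys_def) (auto simp: eq len)
qed

lemma sorted_subset_le_iff:
  assumes "\<forall>I\<in>set Is. finite I"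
  shows "sorted_wrt subset_le Is \<longleftrightarrow> sorted (map sorted_list_of_set Is)"
  using assms by (induction Is) (auto simp: subset_le_iff)

lemma reduced_rep_iff:
  "reduced_rep n Is \<longleftrightarrow> (\<forall>I\<in>set Is. I \<subseteq> {1..n}) \<and> sorted (map sorted_list_of_set Is) \<and>
     (\<forall>K\<in>set Is. count_below K Is \<le> 2)"
proof -
  have "sorted_wrt subset_le Is \<longleftrightarrow> sorted (map sorted_list_of_set Is)"
    if "\<forall>I\<in>set Is. I \<subseteq> {1..n}"
    using that by (intro sorted_subset_le_iff) (meson finite_atLeastAtMost finite_subset)
  then show ?thesis unfolding reduced_rep_def no_triple_iff by blast
qed

text \<open>At least three members lie below K, one of them K itself. After the removal of one copy
  of K two members I and J remain below it, and they absorb K.\<close>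

lemma (in V_valuation) reduce_step:
  assumes K: "K \<in> set Is" "finite K" and big: "\<not> count_below K Is \<le> 2"
  shows "monom_sum Is = monom_sum (remove1 K Is)"
proof -
  define Js where "Js = remove1 K Is"
  have mset: "mset Is = mset (K # Js)"
    using K by (simp add: Js_def)
  then have "length (filter (\<lambda>I. I \<subseteq> K) Js) \<ge> 2"
    using big count_below_mset[OF mset, of K] by (simp add: count_below_def)
  then obtain I J Ls where filt: "filter (\<lambda>I. I \<subseteq> K) Js = I # J # Ls"
    by (metis One_nat_def Suc_le_length_iff numeral_2_eq_2)
  then have "set (I # J # Ls) = {I \<in> set Js. I \<subseteq> K}"
    by (metis set_filter)
  then have IJ: "I \<union> J \<subseteq> K" by auto
  define Ms where "Ms = Ls @ filter (\<lambda>I. \<not> I \<subseteq> K) Js"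
  have "mset Js = mset (filter (\<lambda>I. I \<subseteq> K) Js) + mset (filter (\<lambda>I. \<not> I \<subseteq> K) Js)"
    by simp
  then have Js: "mset Js = mset (I # J # Ms)"
    unfolding filt by (simp add: Ms_def)
  have "monom_sum Is = monom_sum (I # J # K # Ms)"
    by (rule monom_sum_mset_cong) (simp add: mset Js)
  also have "\<dots> = (monom I \<oplus> monom J \<oplus> monom K) \<oplus> monom_sum Ms"
    by (simp add: a_assoc)
  also have "\<dots> = monom_sum (I # J # Ms)"
    unfolding monom_absorb[OF K(2) IJ] by (simp add: a_assoc)
  also have "\<dots> = monom_sum Js"
    by (rule monom_sum_mset_cong) (simp add: Js)
  finally show ?thesis by (simp add: Js_def)
qed

text \<open>Offending members are removed one by one, which shortens the list. The result is chosen
  before the semiring and the valuation, so that it can serve as a normal form.\<close>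

lemma reduce_exists:
  assumes "\<forall>I\<in>set Is. finite I"
  shows "\<exists>Js. set Js \<subseteq> set Is \<and> sorted (map sorted_list_of_set Js) \<and>
     (\<forall>K\<in>set Js. count_below K Js \<le> 2) \<and>
     (\<forall>(R :: 'a ring) v. V_valuation R v \<longrightarrow>
        V_valuation.monom_sum R v Is = V_valuation.monom_sum R v Js)"
  using assms
proof (induction "length Is" arbitrary: Is rule: less_induct)
  case less
  show ?case
  proof (cases "\<forall>K\<in>set Is. count_below K Is \<le> 2")
    case True
    \<comment> \<open>Sorting only permutes the list, so it affects neither the counts nor the
      sum.\<close>
    define Js where "Js = sort_key sorted_list_of_set Is"
    have Js: "mset Is = mset Js" "set Js = set Is" by (simp_all add: Js_def)
    have "\<forall>K\<in>set Js. count_below K Js \<le> 2"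
      using True Js count_below_mset by metis
    moreover have "\<forall>(R :: 'a ring) v. V_valuation R v \<longrightarrow>
        V_valuation.monom_sum R v Is = V_valuation.monom_sum R v Js"
      using V_valuation.monom_sum_mset_cong[OF _ Js(1)] by blast
    moreover have "sorted (map sorted_list_of_set Js)"
      by (simp add: Js_def)
    ultimately show ?thesis
      using Js(2) by blast
  next
    case False
    then obtain K where K: "K \<in> set Is" "\<not> count_below K Is \<le> 2" by blast
    define Ls where "Ls = remove1 K Is"
    have len: "length Ls < length Is"
      using K(1) length_pos_if_in_set[OF K(1)] by (simp add: Ls_def length_remove1)
    have sub: "set Ls \<subseteq> set Is"
      by (simp add: Ls_def set_remove1_subset)
    obtain Js where Js: "set Js \<subseteq> set Ls" "sorted (map sorted_list_of_set Js)"
        "\<forall>K\<in>set Js. count_below K Js \<le> 2"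
        "\<And>(R :: 'a ring) v. V_valuation R v \<Longrightarrow>
           V_valuation.monom_sum R v Ls = V_valuation.monom_sum R v Js"
      using less.hyps[OF len] less.prems sub by (metis subset_iff)
    have "V_valuation.monom_sum R v Is = V_valuation.monom_sum R v Js"
      if R: "V_valuation R v" for R :: "'a ring" and v
      using V_valuation.reduce_step[OF R K(1) _ K(2)] Js(4)[OF R] less.prems K(1)
      by (simp add: Ls_def)
    with Js sub show ?thesis by blast
  qed
qed

text \<open>In a reduced list, the multiplicity of \<open>K\<close> can be read off from the multiplicities of its
  proper subsets and the truncated number of members below \<open>K\<close>.\<close>

lemma reduced_unique:
  assumes fin: "\<forall>I\<in>set Is. finite I" "\<forall>I\<in>set Js. finite I"
    and red: "\<forall>K\<in>set Is. count_below K Is \<le> 2" "\<forall>K\<in>set Js. count_below K Js \<le> 2"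
    and eq: "\<And>K. finite K \<Longrightarrow> min 2 (count_below K Is) = min 2 (count_below K Js)"
  shows "mset Is = mset Js"
proof -
  define below where "below K Ls = length (filter (\<lambda>I. I \<subset> K) Ls)" for K :: "nat set" and Ls
  have split: "count_below K Ls = count (mset Ls) K + below K Ls" for K Ls
    by (induction Ls) (auto simp: count_below_def below_def)
  have "count (mset Is) K = count (mset Js) K" if "finite K" for K
    using that
  proof (induction K rule: finite_psubset_induct)
    case (psubset K)
    have "filter_mset (\<lambda>I. I \<subset> K) (mset Is) = filter_mset (\<lambda>I. I \<subset> K) (mset Js)"
      by (rule multiset_eqI) (simp add: psubset.IH)
    then have "below K Is = below K Js"
      unfolding below_def by (metis mset_filter size_mset)
    moreover have "K \<notin> set Is \<Longrightarrow> count (mset Is) K = 0" "K \<notin> set Js \<Longrightarrow> count (mset Js) K = 0"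
      by (simp_all add: count_eq_zero_iff)
    moreover have "K \<in> set Is \<Longrightarrow> count (mset Is) K > 0" "K \<in> set Js \<Longrightarrow> count (mset Js) K > 0"
      by simp_all
    \<comment> \<open>If K occurs in a list, its count there is at most 2 and truncation loses
      nothing. If K occurred in one list only, fewer than two proper subsets would lie below it, so
      the other count would be exact too and the counts would differ.\<close>
    ultimately show ?case
      using red[rule_format, of K] eq[OF psubset.hyps] unfolding split
      by (cases "K \<in> set Is"; cases "K \<in> set Js") linarith+
  qed
  moreover have "count (mset Is) K = count (mset Js) K" if "infinite K" for K
    using that fin by (metis count_eq_zero_iff set_mset_mset)
  ultimately show ?thesis by (intro multiset_eqI) blast
qed


section \<open>The three-element member\<close>

definition trunc :: "nat ring" where
  "trunc = \<lparr> carrier = {0, 1, 2}, mult = (\<lambda>x y. min 2 (x * y)), one = 1, zero = 0,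
     add = (\<lambda>x y. min 2 (x + y)) \<rparr>"

lemma trunc_simps [simp]:
  "carrier trunc = {0, 1, 2}" "x \<otimes>\<^bsub>trunc\<^esub> y = min 2 (x * y)" "\<one>\<^bsub>trunc\<^esub> = 1"
  "\<zero>\<^bsub>trunc\<^esub> = 0" "x \<oplus>\<^bsub>trunc\<^esub> y = min 2 (x + y)"
  by (simp_all add: trunc_def)

text \<open>For the defining identity: if xyz is nonzero then so are x and y, and x + y has already
  reached the ceiling 2.\<close>

lemma V_semiring_trunc: "V_semiring trunc"
  by unfold_locales auto

definition val :: "nat set \<Rightarrow> sterm \<Rightarrow> nat" where
  "val K = eval_term trunc (\<lambda>i. of_bool (i \<in> K))"

lemma val_simps [simp]:
  "val K (TVar i) = of_bool (i \<in> K)" "val K TZero = 0" "val K TOne = 1"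
  "val K (TAdd t u) = min 2 (val K t + val K u)" "val K (TMul t u) = min 2 (val K t * val K u)"
  by (simp_all add: val_def)

lemma V_valuation_trunc: "V_valuation trunc (\<lambda>i. of_bool (i \<in> K))"
  unfolding V_valuation_def V_valuation_axioms_def
  by (simp add: V_semiring_trunc)

lemma val_rep_term:
  assumes "\<forall>I\<in>set Is. finite I"
  shows "val K (rep_term Is) = min 2 (count_below K Is)"
proof -
  interpret V_valuation trunc "\<lambda>i. of_bool (i \<in> K)" by (rule V_valuation_trunc)
  have "monom I = of_bool (I \<subseteq> K)" if "finite I" for I
    using that
    by induction (auto simp: monom_insert)
  then have "monom_sum Is = min 2 (count_below K Is)"
    using assms by (induction Is) (auto simp: count_below_def)
  then show ?thesis
    unfolding val_def using eval_rep_term[OF assms] by simp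
qed

lemma V_models_val: "V_models t u \<Longrightarrow> val K t = val K u"
  using V_valuation_trunc[of K] V_semiring_trunc
  by (simp add: V_models_def val_def V_valuation_def V_valuation_axioms_def)

lemma val_Int_vars: "vars t \<subseteq> V \<Longrightarrow> val (K \<inter> V) t = val K t"
  by (induction t) auto

text \<open>The sets are bounded by \<open>vars t\<close> rather than by some {1..n}, so that the
  lemma also covers arbitrary terms, including those with variable 0.\<close>

lemma reduced_form_exists:
  "\<exists>Is. (\<forall>I\<in>set Is. I \<subseteq> vars t) \<and> sorted (map sorted_list_of_set Is) \<and>
     (\<forall>K\<in>set Is. count_below K Is \<le> 2) \<and> V_models t (rep_term Is)"
proof -
  have fin: "\<forall>I\<in>set (monomials t). finite I"
    by (simp add: finite_monomials)
  then obtain Is where Is: "set Is \<subseteq> set (monomials t)" "sorted (map sorted_list_of_set Is)"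
      "\<forall>K\<in>set Is. count_below K Is \<le> 2"
      "\<And>(R :: nat ring) v. V_valuation R v \<Longrightarrow>
        V_valuation.monom_sum R v (monomials t) = V_valuation.monom_sum R v Is"
    using reduce_exists by metis
  then have sub: "\<forall>I\<in>set Is. I \<subseteq> vars t" and fin': "\<forall>I\<in>set Is. finite I"
    using monomials_subset fin by blast+
  have "V_models t (rep_term Is)"
    unfolding V_models_def
  proof (intro allI impI)
    fix R :: "nat ring" and v :: "nat \<Rightarrow> nat"
    assume "V_semiring R" "\<forall>i. v i \<in> carrier R"
    then interpret V_valuation R v
      by (simp add: V_valuation_def V_valuation_axioms_def)
    show "eval_term R v t = eval_term R v (rep_term Is)"
      using Is(4)[OF V_valuation_axioms] by (simp add: eval_monomials[of t] eval_rep_term fin')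
  qed
  with Is sub show ?thesis by blast
qed

lemma reduced_form_unique:
  assumes "\<forall>I\<in>set Is. finite I" "sorted (map sorted_list_of_set Is)"
    "\<forall>K\<in>set Is. count_below K Is \<le> 2"
    and "\<forall>I\<in>set Js. finite I" "sorted (map sorted_list_of_set Js)"
    "\<forall>K\<in>set Js. count_below K Js \<le> 2"
    and "\<And>K. finite K \<Longrightarrow> val K (rep_term Is) = val K (rep_term Js)"
  shows "Is = Js"
proof -
  have "mset Is = mset Js"
    using assms by (intro reduced_unique) (simp_all add: val_rep_term)
  then have "mset (map sorted_list_of_set Is) = mset (map sorted_list_of_set Js)"
    by simp
  with assms(2,5) have "map sorted_list_of_set Is = map sorted_list_of_set Js"
    by (metis properties_for_sort)
  moreover have "inj_on sorted_list_of_set (set Is \<union> set Js)"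
    using assms(1,4) by (auto intro!: inj_onI dest: arg_cong[where f = set])
  ultimately show ?thesis by (rule map_inj_on)
qed

text \<open>If the values agree, the reduced forms of both terms agree under all 0-1 valuations and
  hence coincide. Restricting K to the occurring variables leaves finitely many tests, on which
  local finiteness and decidability rest.\<close>

lemma V_models_iff_val: "V_models t u \<longleftrightarrow> (\<forall>K\<subseteq>vars t \<union> vars u. val K t = val K u)"
proof
  assume eq: "\<forall>K\<subseteq>vars t \<union> vars u. val K t = val K u"
  have eq': "val K t = val K u" for K
    using eq[rule_format, of "K \<inter> (vars t \<union> vars u)"] by (simp add: val_Int_vars)
  obtain Is where Is: "\<forall>I\<in>set Is. I \<subseteq> vars t" "sorted (map sorted_list_of_set Is)"
      "\<forall>K\<in>set Is. count_below K Is \<le> 2" "V_models t (rep_term Is)"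
    using reduced_form_exists[of t] by blast
  obtain Js where Js: "\<forall>I\<in>set Js. I \<subseteq> vars u" "sorted (map sorted_list_of_set Js)"
      "\<forall>K\<in>set Js. count_below K Js \<le> 2" "V_models u (rep_term Js)"
    using reduced_form_exists[of u] by blast
  have "Is = Js"
  proof (rule reduced_form_unique)
    show "\<forall>I\<in>set Is. finite I" "\<forall>I\<in>set Js. finite I"
      using Is(1) Js(1) by (meson finite_subset finite_vars)+
    show "val K (rep_term Is) = val K (rep_term Js)" for K
      using V_models_val[OF Is(4), of K] V_models_val[OF Js(4), of K] eq'[of K] by simp
  qed (fact Is Js)+
  with Is(4) Js(4) show "V_models t u" by (simp add: V_models_def)
qed (simp add: V_models_val)

lemma normal_form:
  assumes "vars t \<subseteq> {1..n}"
  shows "\<exists>!Is. reduced_rep n Is \<and> V_models t (rep_term Is)"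
proof (rule ex_ex1I)
  show "\<exists>Is. reduced_rep n Is \<and> V_models t (rep_term Is)"
    using reduced_form_exists[of t] assms by (meson reduced_rep_iff subset_trans)
next
  fix Is Js
  assume Is: "reduced_rep n Is \<and> V_models t (rep_term Is)"
    and Js: "reduced_rep n Js \<and> V_models t (rep_term Js)"
  show "Is = Js"
  proof (rule reduced_form_unique)
    show "\<forall>I\<in>set Is. finite I" "\<forall>I\<in>set Js. finite I"
      using Is Js unfolding reduced_rep_iff by (meson finite_subset finite_atLeastAtMost)+
    show "val K (rep_term Is) = val K (rep_term Js)" for K
      using Is Js V_models_val[of t _ K] by metis
  qed (use Is Js in \<open>simp_all add: reduced_rep_iff\<close>)
qed


section \<open>Local finiteness\<close>

text \<open>Every element is the value of a term in n variables. Terms with the same table of values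
  in {0, 1, 2} under the 0-1 valuations are equal in the variety, and there are finitely many such
  tables.\<close>

lemma locally_finite:
  fixes R :: "'a ring" (structure)
  assumes R: "V_semiring R" and "finitely_generated R"
  shows "finite (carrier R)"
proof -
  obtain G where G: "finite G" "G \<subseteq> carrier R"
      and gen: "carrier R = \<Inter>{H. subsemiring H R \<and> G \<subseteq> H}"
    using assms(2) by (auto simp: finitely_generated_def)
  obtain g and n :: nat where g: "G = g ` {..<n}"
    using finite_imp_nat_seg_image_inj_on[OF G(1)] by (auto simp: lessThan_def)
  \<comment> \<open>The default zero makes \<open>v\<close> a valuation of all variables in the
    carrier.\<close>
  define v where "v i = (if i < n then g i else \<zero>\<^bsub>R\<^esub>)" for i
  have v: "v i \<in> carrier R" for i using g G(2) R by (auto simp: v_def V_semiring_def semiring_def abelian_monoid.zero_closed)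
  interpret V_valuation R v
    using R v by (simp add: V_valuation_def V_valuation_axioms_def)
  define T where "T = {t. vars t \<subseteq> {..<n}}"
  have "subsemiring (eval_term R v ` T) R"
    unfolding subsemiring_def
  proof (intro conjI ballI)
    show "eval_term R v ` T \<subseteq> carrier R"
      using eval_term_closed by auto
    show "\<zero> \<in> eval_term R v ` T" by (rule image_eqI[of _ _ TZero]) (simp_all add: T_def)
    show "\<one> \<in> eval_term R v ` T" by (rule image_eqI[of _ _ TOne]) (simp_all add: T_def)
  next
    fix x y assume "x \<in> eval_term R v ` T" "y \<in> eval_term R v ` T"
    then obtain t u where tu: "t \<in> T" "u \<in> T" "x = eval_term R v t" "y = eval_term R v u" by auto
    show "x \<oplus> y \<in> eval_term R v ` T"
      by (rule image_eqI[of _ _ "TAdd t u"]) (use tu in \<open>simp_all add: T_def\<close>)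
    show "x \<otimes> y \<in> eval_term R v ` T"
      by (rule image_eqI[of _ _ "TMul t u"]) (use tu in \<open>simp_all add: T_def\<close>)
  qed
  moreover have "G \<subseteq> eval_term R v ` T"
    unfolding g by (auto simp: T_def v_def intro!: image_eqI[of _ _ "TVar _"])
  ultimately have sub: "carrier R \<subseteq> eval_term R v ` T"
    using gen by blast
  define vals where "vals t = (\<lambda>K\<in>Pow {..<n}. val K t)" for t
  have factor: "eval_term R v t = eval_term R v u" if "t \<in> T" "u \<in> T" "vals t = vals u" for t u
  proof -
    have "val K t = val K u" if "K \<subseteq> {..<n}" for K
      using fun_cong[OF \<open>vals t = vals u\<close>, of K] that by (simp add: vals_def)
    then have "V_models t u"
      using that(1,2) by (auto simp: V_models_iff_val T_def)
    then show ?thesis by (rule V_models_all_types) (fact R v)+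
  qed
  have "val K t \<in> {..2}" for K t
    by (induction t) auto
  then have "vals ` T \<subseteq> (\<Pi>\<^sub>E K\<in>Pow {..<n}. {..2})"
    unfolding vals_def by (intro image_subsetI) (simp only: restrict_PiE_iff, blast)
  then have "finite (vals ` T)"
    by (rule finite_subset) (simp add: finite_PiE)
  \<comment> \<open>One representative term per table yields all values.\<close>
  moreover have "eval_term R v ` T = (\<lambda>c. eval_term R v (inv_into T vals c)) ` vals ` T"
  proof -
    have "eval_term R v (inv_into T vals (vals t)) = eval_term R v t" if "t \<in> T" for t
      using that by (intro factor) (auto intro: inv_into_into f_inv_into_f)
    then show ?thesis by (force simp: image_image)
  qed
  ultimately show ?thesis using sub by (metis finite_imageI finite_subset)
qed


section \<open>Recursive functions\<close>

named_theorems recursive_intros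

text \<open>Pointwise forms of composition let the later closure proofs follow the syntax of an
  expression.\<close>

lemma recursive_comp1:
  assumes "recursive 1 (\<lambda>xs. f (xs ! 0))" "recursive k a"
  shows "recursive k (\<lambda>xs. f (a xs))"
  using recursive.comp[of "[a]" "\<lambda>xs. f (xs ! 0)" k] assms by simp

lemma recursive_comp2:
  assumes "recursive 2 (\<lambda>xs. f (xs ! 0) (xs ! 1))" "recursive k a" "recursive k b"
  shows "recursive k (\<lambda>xs. f (a xs) (b xs))"
  using recursive.comp[of "[a, b]" "\<lambda>xs. f (xs ! 0) (xs ! 1)" k] assms
  by (simp add: numeral_2_eq_2)

lemma recursive_comp3:
  assumes "recursive 3 (\<lambda>xs. f (xs ! 0) (xs ! 1) (xs ! 2))"
    "recursive k a" "recursive k b" "recursive k c"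
  shows "recursive k (\<lambda>xs. f (a xs) (b xs) (c xs))"
  using recursive.comp[of "[a, b, c]" "\<lambda>xs. f (xs ! 0) (xs ! 1) (xs ! 2)" k] assms
  by (simp add: numeral_3_eq_3 numeral_2_eq_2)

lemma recursive_Suc [recursive_intros]: "recursive k a \<Longrightarrow> recursive k (\<lambda>xs. Suc (a xs))"
  by (rule recursive_comp1[OF recursive.succ])

lemma recursive_const [recursive_intros]: "recursive k (\<lambda>xs. c)"
  by (induction c) (auto intro: recursive.zero recursive_Suc)

lemma recursive_proj [recursive_intros]: "i < k \<Longrightarrow> recursive k (\<lambda>xs. xs ! i)"
  by (rule recursive.proj)

text \<open>\<open>recursive.prim\<close> recurses on the head of the argument list, with the tail
  as parameters. Here the number of steps and the single parameter are arbitrary recursive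
  functions.\<close>

lemma recursive_rec1:
  assumes "recursive 1 (\<lambda>xs. f (xs ! 0))"
    and "recursive 3 (\<lambda>xs. g (xs ! 0) (xs ! 1) (xs ! 2))"
    and "recursive k n" "recursive k x"
  shows "recursive k (\<lambda>xs. rec_nat (f (x xs)) (\<lambda>y r. g y r (x xs)) (n xs))"
proof -
  have "recursive 2 (\<lambda>xs. rec_nat (f (xs ! 1)) (\<lambda>y r. g y r (xs ! 1)) (xs ! 0))"
  proof (rule recursive.ext)
    show "recursive 2 (\<lambda>xs. rec_nat (f (tl xs ! 0))
        (\<lambda>y r. g ((y # r # tl xs) ! 0) ((y # r # tl xs) ! 1) ((y # r # tl xs) ! 2)) (hd xs))"
      using recursive.prim[of 1 "\<lambda>xs. f (xs ! 0)" "\<lambda>xs. g (xs ! 0) (xs ! 1) (xs ! 2)"] assms(1,2)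
      by (simp add: numeral_3_eq_3 numeral_2_eq_2)
  qed (auto simp: numeral_2_eq_2 length_Suc_conv)
  then show ?thesis
    by (rule recursive_comp2[where f = "\<lambda>n x. rec_nat (f x) (\<lambda>y r. g y r x) n", OF _ assms(3,4)])
qed

lemma recursive_rec2:
  assumes "recursive 2 (\<lambda>xs. f (xs ! 0) (xs ! 1))"
    and "recursive 4 (\<lambda>xs. g (xs ! 0) (xs ! 1) (xs ! 2) (xs ! 3))"
    and "recursive k n" "recursive k x" "recursive k z"
  shows "recursive k (\<lambda>xs. rec_nat (f (x xs) (z xs)) (\<lambda>y r. g y r (x xs) (z xs)) (n xs))"
proof -
  have "recursive 3 (\<lambda>xs. rec_nat (f (xs ! 1) (xs ! 2)) (\<lambda>y r. g y r (xs ! 1) (xs ! 2)) (xs ! 0))"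
  proof (rule recursive.ext)
    show "recursive 3 (\<lambda>xs. rec_nat (f (tl xs ! 0) (tl xs ! 1))
        (\<lambda>y r. g ((y # r # tl xs) ! 0) ((y # r # tl xs) ! 1) ((y # r # tl xs) ! 2)
          ((y # r # tl xs) ! 3)) (hd xs))"
      using recursive.prim[of 2 "\<lambda>xs. f (xs ! 0) (xs ! 1)"
          "\<lambda>xs. g (xs ! 0) (xs ! 1) (xs ! 2) (xs ! 3)"] assms(1,2)
      by (simp add: eval_nat_numeral)
  qed (auto simp: eval_nat_numeral length_Suc_conv)
  then show ?thesis
    by (rule recursive_comp3[where f = "\<lambda>n x z. rec_nat (f x z) (\<lambda>y r. g y r x z) n",
          OF _ assms(3-5)])
qed

lemma recursive_add [recursive_intros]:
  assumes "recursive k a" "recursive k b"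
  shows "recursive k (\<lambda>xs. a xs + b xs)"
proof -
  have "rec_nat x (\<lambda>y r. Suc r) n = n + x" for x n :: nat
    by (induction n) auto
  moreover have "recursive k (\<lambda>xs. rec_nat (b xs) (\<lambda>y r. Suc r) (a xs))"
    by (rule recursive_rec1[where f = "\<lambda>x. x" and g = "\<lambda>y r x. Suc r"]) (intro recursive_intros assms; simp)+
  ultimately show ?thesis by simp
qed

lemma recursive_mult [recursive_intros]:
  assumes "recursive k a" "recursive k b"
  shows "recursive k (\<lambda>xs. a xs * b xs)"
proof -
  have "rec_nat 0 (\<lambda>y r. r + x) n = n * x" for x n :: nat
    by (induction n) auto
  moreover have "recursive k (\<lambda>xs. rec_nat 0 (\<lambda>y r. r + b xs) (a xs))"
    by (rule recursive_rec1[where f = "\<lambda>x. 0" and g = "\<lambda>y r x. r + x"]) (intro recursive_intros assms; simp)+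
  ultimately show ?thesis by simp
qed

lemma recursive_power [recursive_intros]:
  assumes "recursive k a" "recursive k b"
  shows "recursive k (\<lambda>xs. a xs ^ b xs)"
proof -
  have "rec_nat 1 (\<lambda>y r. r * x) n = x ^ n" for x n :: nat
    by (induction n) auto
  moreover have "recursive k (\<lambda>xs. rec_nat 1 (\<lambda>y r. r * a xs) (b xs))"
    by (rule recursive_rec1[where f = "\<lambda>x. 1" and g = "\<lambda>y r x. r * x"]) (intro recursive_intros assms; simp)+
  ultimately show ?thesis by simp
qed

lemma recursive_diff [recursive_intros]:
  assumes "recursive k a" "recursive k b"
  shows "recursive k (\<lambda>xs. a xs - b xs)"
proof -
  have pred: "recursive k (\<lambda>xs. a xs - 1)" if "recursive k a" for k a
  proof -
    have "rec_nat 0 (\<lambda>y r. y) n = n - 1" for n :: nat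
      by (cases n) auto
    moreover have "recursive k (\<lambda>xs. rec_nat 0 (\<lambda>y r. y) (a xs))"
      by (rule recursive_rec1[where f = "\<lambda>x. 0" and g = "\<lambda>y r x. y" and x = a]) (intro recursive_intros that; simp)+
    ultimately show ?thesis by simp
  qed
  have "rec_nat x (\<lambda>y r. r - 1) n = x - n" for x n :: nat
    by (induction n) auto
  moreover have "recursive k (\<lambda>xs. rec_nat (a xs) (\<lambda>y r. r - 1) (b xs))"
    by (rule recursive_rec1[where f = "\<lambda>x. x" and g = "\<lambda>y r x. r - 1"]) (intro recursive_intros pred assms; simp)+
  ultimately show ?thesis by simp
qed

lemma recursive_le [recursive_intros]:
  assumes "recursive k a" "recursive k b"
  shows "recursive k (\<lambda>xs. of_bool (a xs \<le> b xs))"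
proof -
  have "recursive k (\<lambda>xs. 1 - (a xs - b xs))" by (intro recursive_intros assms)
  moreover have "1 - (m - n) = of_bool (m \<le> n)" for m n :: nat by auto
  ultimately show ?thesis by simp
qed

lemma recursive_eq [recursive_intros]:
  assumes "recursive k a" "recursive k b"
  shows "recursive k (\<lambda>xs. of_bool (a xs = b xs))"
proof -
  have "recursive k (\<lambda>xs. of_bool (a xs \<le> b xs) * of_bool (b xs \<le> a xs))" by (intro recursive_intros assms)
  moreover have "of_bool (m \<le> n) * of_bool (n \<le> m) = (of_bool (m = n) :: nat)" for m n :: nat
    by auto
  ultimately show ?thesis by simp
qed

lemma recursive_min [recursive_intros]:
  assumes "recursive k a" "recursive k b"
  shows "recursive k (\<lambda>xs. min (a xs) (b xs))"
proof -
  have "recursive k (\<lambda>xs. a xs - (a xs - b xs))" by (intro recursive_intros assms)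
  moreover have "m - (m - n) = min m n" for m n :: nat by auto
  ultimately show ?thesis by simp
qed

lemma recursive_sum1:
  assumes "recursive 2 (\<lambda>xs. f (xs ! 0) (xs ! 1))" "recursive k n" "recursive k x"
  shows "recursive k (\<lambda>xs. \<Sum>i<n xs. f i (x xs))"
proof -
  have "rec_nat 0 (\<lambda>y r. r + f y x) n = (\<Sum>i<n. f i x)" for x n
    by (induction n) auto
  moreover have "recursive 3 (\<lambda>xs. f (xs ! 0) (xs ! 2))"
    by (rule recursive_comp2[OF assms(1)]) (intro recursive_intros; simp)+
  then have "recursive k (\<lambda>xs. rec_nat 0 (\<lambda>y r. r + f y (x xs)) (n xs))"
    by (intro recursive_rec1[where f = "\<lambda>x. 0" and g = "\<lambda>y r x. r + f y x"]
        recursive_intros assms(2,3)) simp_all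
  ultimately show ?thesis by simp
qed

lemma recursive_sum2:
  assumes "recursive 3 (\<lambda>xs. f (xs ! 0) (xs ! 1) (xs ! 2))"
    "recursive k n" "recursive k x" "recursive k z"
  shows "recursive k (\<lambda>xs. \<Sum>i<n xs. f i (x xs) (z xs))"
proof -
  have "rec_nat 0 (\<lambda>y r. r + f y x z) n = (\<Sum>i<n. f i x z)" for x z n
    by (induction n) auto
  moreover have "recursive 4 (\<lambda>xs. f (xs ! 0) (xs ! 2) (xs ! 3))"
    by (rule recursive_comp3[OF assms(1)]) (intro recursive_intros; simp)+
  then have "recursive k (\<lambda>xs. rec_nat 0 (\<lambda>y r. r + f y (x xs) (z xs)) (n xs))"
    by (intro recursive_rec2[where f = "\<lambda>x z. 0" and g = "\<lambda>y r x z. r + f y x z"]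
        recursive_intros assms(2-4)) simp_all
  ultimately show ?thesis by simp
qed

lemma recursive_div [recursive_intros]:
  assumes a: "recursive k a" and b: "recursive k b" and pos: "\<And>xs. b xs > 0"
  shows "recursive k (\<lambda>xs. a xs div b xs)"
proof -
  \<comment> \<open>The quotient is the number of positive multiples of n up to m. For n = 0 the sum
    would be m, whereas \<open>m div 0\<close> is 0.\<close>
  have "(\<Sum>q<m. of_bool (Suc q * n \<le> m)) = m div n" if "n > 0" for m n :: nat
  proof -
    have "Suc q * n \<le> m \<longleftrightarrow> q < m div n" for q
      using that by (metis Suc_le_eq less_eq_div_iff_mult_less_eq)
    moreover have "q < m" if "q < m div n" for q
      using that by (meson div_le_dividend less_le_trans)
    ultimately have "{q. q < m \<and> Suc q * n \<le> m} = {..<m div n}" by auto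
    then show ?thesis by (simp add: Collect_conj_eq lessThan_def)
  qed
  moreover have "recursive k (\<lambda>xs. \<Sum>q<a xs. of_bool (Suc q * b xs \<le> a xs))"
    by (rule recursive_sum2[where f = "\<lambda>q n m. of_bool (Suc q * n \<le> m)"]) (intro recursive_intros a b; simp)+
  ultimately show ?thesis using pos by simp
qed

lemma recursive_mod [recursive_intros]:
  assumes a: "recursive k a" and b: "recursive k b" and pos: "\<And>xs. b xs > 0"
  shows "recursive k (\<lambda>xs. a xs mod b xs)"
proof -
  have "recursive k (\<lambda>xs. a xs - a xs div b xs * b xs)" 
    by (intro recursive_intros assms)
  then show ?thesis by (simp add: minus_div_mult_eq_mod)
qed

lemma recursive_prod_encode [recursive_intros]:
  assumes "recursive k a" "recursive k b"
  shows "recursive k (\<lambda>xs. prod_encode (a xs, b xs))"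
  unfolding prod_encode_def triangle_def prod.case by (intro recursive_intros assms) simp

text \<open>Decoding is a bounded search: both components are at most the code, so exactly one pair
  in the range passes the equality test. The weight \<open>w\<close> in the double sum selects what
  is returned for it.\<close>

lemma recursive_prod_decode [recursive_intros]:
  assumes "recursive k a"
  shows "recursive k (\<lambda>xs. fst (prod_decode (a xs)))" "recursive k (\<lambda>xs. snd (prod_decode (a xs)))"
proof -
  define S where "S w p = (\<Sum>x<Suc p. \<Sum>y<Suc p. w x y * of_bool (prod_encode (x, y) = p))"
    for w :: "nat \<Rightarrow> nat \<Rightarrow> nat" and p
  have S: "S w p = w (fst (prod_decode p)) (snd (prod_decode p))" for w p
  proof -
    define x y where "x = fst (prod_decode p)" and "y = snd (prod_decode p)"
    have p: "prod_encode (x, y) = p" by (simp add: x_def y_def)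
    have "S w p = (\<Sum>z\<in>{..<Suc p} \<times> {..<Suc p}. if z = (x, y) then w x y else 0)"
      unfolding S_def sum.cartesian_product
      by (rule sum.cong) (auto simp: p[symmetric] prod_encode_eq)
    also have "\<dots> = w x y"
      using le_prod_encode_1[of x y] le_prod_encode_2[of y x] by (simp add: p)
    finally show ?thesis by (simp add: x_def y_def)
  qed
  have rec: "recursive k (\<lambda>xs. S w (a xs))"
    if "recursive 3 (\<lambda>xs. w (xs ! 1) (xs ! 0))" for w
  proof -
    have "recursive 2 (\<lambda>xs. \<Sum>y<Suc (xs ! 1). w (xs ! 0) y * of_bool (prod_encode (xs ! 0, y) = xs ! 1))"
      by (rule recursive_sum2[where f = "\<lambda>y x p. w x y * of_bool (prod_encode (x, y) = p)"])
        (intro recursive_intros that; simp)+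
    then show ?thesis unfolding S_def
      by (rule recursive_sum1[where f = "\<lambda>x p. \<Sum>y<Suc p. w x y * of_bool (prod_encode (x, y) = p)"])
        (intro recursive_intros assms; simp)+
  qed
  from rec[of "\<lambda>x y. x"] show "recursive k (\<lambda>xs. fst (prod_decode (a xs)))"
    by (simp add: S recursive_intros)
  from rec[of "\<lambda>x y. y"] show "recursive k (\<lambda>xs. snd (prod_decode (a xs)))"
    by (simp add: S recursive_intros)
qed


section \<open>Decidability\<close>

definition digit :: "nat \<Rightarrow> nat \<Rightarrow> nat" where
  "digit w i = w div 3 ^ i mod 3"

text \<open>Evaluates the top node of the term coded by c, reading the values of its arguments from
  the digits of w. At most one tag test succeeds, and \<open>min 2 p\<close> keeps the result a
  base-3 digit even if c codes no term.\<close>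

definition node_val :: "nat \<Rightarrow> nat \<Rightarrow> nat \<Rightarrow> nat" where
  "node_val b c w =
     (let tag = fst (prod_decode c); p = snd (prod_decode c);
          l = digit w (fst (prod_decode p)); r = digit w (snd (prod_decode p))
      in of_bool (tag = 0) * min 2 p + of_bool (tag = 1) * (b div 2 ^ p mod 2)
         + of_bool (tag = 2) * min 2 (l + r) + of_bool (tag = 3) * min 2 (l * r))"

text \<open>The base-3 digits of \<open>val_table b n\<close> are the values of all terms with code below \<open>n\<close> under
  the 0-1 valuation given by the bits of \<open>b\<close>. This turns the course-of-values recursion on codes
  into a primitive recursion.\<close>

definition val_table :: "nat \<Rightarrow> nat \<Rightarrow> nat" where
  "val_table b n = rec_nat 0 (\<lambda>c w. w + 3 ^ c * node_val b c w) n"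

lemma val_table_simps [simp]:
  "val_table b 0 = 0"
  "val_table b (Suc n) = val_table b n + 3 ^ n * node_val b n (val_table b n)"
  by (simp_all add: val_table_def)

lemma node_val_le: "node_val b c w \<le> 2"
  unfolding node_val_def Let_def by (auto simp: of_bool_def) 

lemma val_table_less: "val_table b n < 3 ^ n"
proof (induction n)
  case (Suc n)
  have "3 ^ n * node_val b n (val_table b n) \<le> 3 ^ n * 2"
    by (simp add: node_val_le)
  with Suc show ?case
    unfolding val_table_simps power_Suc by linarith
qed simp

text \<open>Stage n adds a multiple of \<open>3 ^ n\<close>, so it sets digit n and leaves all lower
  digits as they were.\<close>

lemma digit_val_table:
  assumes "c < n"
  shows "digit (val_table b n) c = node_val b c (val_table b c)"
  using assms
proof (induction n)
  case (Suc n)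
  let ?s = "node_val b n (val_table b n)"
  show ?case
  proof (cases "c = n")
    case True
    have "digit (val_table b (Suc n)) n = (val_table b n div 3 ^ n + ?s) mod 3"
      by (simp add: digit_def add.commute)
    also have "\<dots> = ?s"
      using node_val_le[of b n "val_table b n"] by (simp add: val_table_less)
    finally show ?thesis using True by simp
  next
    case False
    with Suc.prems have "c < n" by simp
    then obtain m where m: "n = c + Suc m"
      using less_iff_Suc_add by auto
    have "(w + 3 ^ n * s) div 3 ^ c mod 3 = w div 3 ^ c mod 3" for w s :: nat
    proof -
      have "(w + 3 ^ n * s) div 3 ^ c = w div 3 ^ c + 3 * (3 ^ m * s)"
        using div_mult_self2[of "3 ^ c" w "3 * (3 ^ m * s)"]
        by (simp add: m power_add mult_ac)
      then show ?thesis by (simp only: mod_mult_self2)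
    qed
    then have "digit (val_table b (Suc n)) c = digit (val_table b n) c"
      by (simp add: digit_def)
    with Suc.IH \<open>c < n\<close> show ?thesis by simp
  qed
qed simp

text \<open>Ensures that the values of both arguments are already in the table when a compound term
  is reached. With tag 0 it fails, for instance at c = 0 and d = 1.\<close>

lemma code_args_less:
  assumes "i > 0"
  shows "c < prod_encode (i, prod_encode (c, d)) \<and> d < prod_encode (i, prod_encode (c, d))"
proof -
  obtain j where i: "i = Suc j"
    using assms by (cases i) auto
  have "p < prod_encode (i, p)" for p
    by (simp add: i prod_encode_def triangle_def)
  then show ?thesis
    using le_prod_encode_1 le_prod_encode_2 le_less_trans by metis
qed

lemma node_val_code: "node_val b (code t) (val_table b (code t)) = val (set_decode b) t"
proof (induction t)
  case (TAdd t u)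
  let ?c = "code (TAdd t u)"
  have "digit (val_table b ?c) (code t) = val (set_decode b) t"
    "digit (val_table b ?c) (code u) = val (set_decode b) u"
    using TAdd code_args_less[of 2 "code t" "code u"] by (simp_all add: digit_val_table)
  then show ?case by (simp add: node_val_def)
next
  case (TMul t u)
  let ?c = "code (TMul t u)"
  have "digit (val_table b ?c) (code t) = val (set_decode b) t"
    "digit (val_table b ?c) (code u) = val (set_decode b) u"
    using TMul code_args_less[of 3 "code t" "code u"] by (simp_all add: digit_val_table)
  then show ?case by (simp add: node_val_def)
qed (auto simp: node_val_def Let_def set_decode_def odd_iff_mod_2_eq_one)

lemma vars_le_code: "i \<in> vars t \<Longrightarrow> i \<le> code t"
proof (induction t)
  case (TVar j)
  then show ?case using le_prod_encode_2 by simp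
next
  case (TAdd t u)
  with code_args_less[of 2 "code t" "code u"] show ?case
    by (auto intro: order.trans[OF _ less_imp_le])
next
  case (TMul t u)
  with code_args_less[of 3 "code t" "code u"] show ?case
    by (auto intro: order.trans[OF _ less_imp_le])
qed simp_all

lemma set_encode_less:
  assumes "K \<subseteq> {..<n}"
  shows "set_encode K < 2 ^ n"
proof -
  have "set_encode K \<le> set_encode {..<n}"
    unfolding set_encode_def by (rule sum_mono2) (use assms in auto)
  also have "\<dots> < 2 ^ n"
    unfolding set_encode_def by (induction n) auto
  finally show ?thesis .
qed

text \<open>A variable is at most the code of a term it occurs in, so the relevant sets K lie in
  {0..\<open>code t + code u\<close>} and are the bit sets of the numbers b in the stated range.
  This bounds the quantifier by a function of the codes alone.\<close>

lemma V_models_iff_codes: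
  "V_models t u \<longleftrightarrow> (\<forall>b < 2 ^ Suc (code t + code u).
     digit (val_table b (Suc (code t))) (code t) = digit (val_table b (Suc (code u))) (code u))"
proof -
  have "V_models t u \<longleftrightarrow> (\<forall>b < 2 ^ Suc (code t + code u). val (set_decode b) t = val (set_decode b) u)"
  proof
    assume eq: "\<forall>b < 2 ^ Suc (code t + code u). val (set_decode b) t = val (set_decode b) u"
    have "val K t = val K u" if K: "K \<subseteq> vars t \<union> vars u" for K
    proof -
      have "finite K"
        using K finite_vars by (meson finite_Un finite_subset)
      moreover have "K \<subseteq> {..<Suc (code t + code u)}"
        using K vars_le_code by (fastforce simp: less_Suc_eq_le intro: trans_le_add1 trans_le_add2)
      ultimately show ?thesis
        using eq[rule_format, OF set_encode_less, of K] by simp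
    qed
    then show "V_models t u" by (simp add: V_models_iff_val)
  qed (simp add: V_models_val)
  then show ?thesis by (simp add: digit_val_table node_val_code del: val_table_simps)
qed

lemma recursive_digit [recursive_intros]:
  assumes "recursive k w" "recursive k i"
  shows "recursive k (\<lambda>xs. digit (w xs) (i xs))"
  unfolding digit_def by (intro recursive_intros assms) simp_all

lemma recursive_node_val [recursive_intros]:
  assumes "recursive k b" "recursive k c" "recursive k w"
  shows "recursive k (\<lambda>xs. node_val (b xs) (c xs) (w xs))"
  unfolding node_val_def Let_def
  by (intro recursive_intros assms) simp_all

lemma recursive_val_table [recursive_intros]:
  assumes "recursive k b" "recursive k n"
  shows "recursive k (\<lambda>xs. val_table (b xs) (n xs))"
  unfolding val_table_def
  by (rule recursive_rec1[where f = "\<lambda>x. 0" and g = "\<lambda>c w b. w + 3 ^ c * node_val b c w"])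
    (intro recursive_intros assms; simp)+

lemma V_models_decidable: "algorithmically_decidable V_models"
  unfolding algorithmically_decidable_def
proof (intro exI conjI allI)
  \<comment> \<open>The sum in \<open>f\<close> counts the valuations that separate the two terms;
    truncated subtraction from 1 tests whether there are none.\<close>
  define ne where "ne b c d =
    1 - (of_bool (digit (val_table b (Suc c)) c = digit (val_table b (Suc d)) d) :: nat)" for b c d
  define f where "f xs = 1 - (\<Sum>b<2 ^ Suc (xs ! 0 + xs ! 1). ne b (xs ! 0) (xs ! 1))" for xs
  have "recursive 3 (\<lambda>xs. ne (xs ! 0) (xs ! 1) (xs ! 2))"
    unfolding ne_def
    by (intro recursive_intros) simp_all
  then show "recursive 2 f"
    unfolding f_def by (intro recursive_intros recursive_sum2) simp_all
  show "f [code t, code u] = (if V_models t u then 1 else 0)" for t u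
  proof (cases "V_models t u")
    case True
    then have "ne b (code t) (code u) = 0" if "b < 2 ^ Suc (code t + code u)" for b
      using that unfolding V_models_iff_codes ne_def by simp
    then have "(\<Sum>b<2 ^ Suc (code t + code u). ne b (code t) (code u)) = 0"
      by (intro sum.neutral) auto
    with True show ?thesis by (simp add: f_def)
  next
    case False
    then obtain b where b: "b < 2 ^ Suc (code t + code u)" "ne b (code t) (code u) = 1"
      unfolding V_models_iff_codes ne_def by auto
    have "ne b (code t) (code u) \<le> (\<Sum>b<2 ^ Suc (code t + code u). ne b (code t) (code u))"
      by (rule member_le_sum) (use b in auto)
    with b False show ?thesis by (simp add: f_def)
  qed
qed


section \<open>Subdirectly irreducible members\<close>

definition transport :: "('a \<Rightarrow> 'b) \<Rightarrow> 'a ring \<Rightarrow> 'b ring" where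
  "transport e R = (let d = inv_into (carrier R) e in
     \<lparr> carrier = e ` carrier R, mult = (\<lambda>x y. e (d x \<otimes>\<^bsub>R\<^esub> d y)), one = e \<one>\<^bsub>R\<^esub>,
       zero = e \<zero>\<^bsub>R\<^esub>, add = (\<lambda>x y. e (d x \<oplus>\<^bsub>R\<^esub> d y)) \<rparr>)"

lemma transport_simps:
  assumes "inj_on e (carrier R)"
  shows "carrier (transport e R) = e ` carrier R"
    and "\<one>\<^bsub>transport e R\<^esub> = e \<one>\<^bsub>R\<^esub>" and "\<zero>\<^bsub>transport e R\<^esub> = e \<zero>\<^bsub>R\<^esub>"
    and "\<lbrakk>x \<in> carrier R; y \<in> carrier R\<rbrakk> \<Longrightarrow> e x \<otimes>\<^bsub>transport e R\<^esub> e y = e (x \<otimes>\<^bsub>R\<^esub> y)"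
    and "\<lbrakk>x \<in> carrier R; y \<in> carrier R\<rbrakk> \<Longrightarrow> e x \<oplus>\<^bsub>transport e R\<^esub> e y = e (x \<oplus>\<^bsub>R\<^esub> y)"
  using assms by (simp_all add: transport_def Let_def)

lemma V_semiring_transport:
  fixes R :: "'a ring"
  assumes R: "V_semiring R" and e: "inj_on e (carrier R)"
  shows "V_semiring (transport e R)"
proof -
  interpret V_semiring R by fact
  \<comment> \<open>The right-nested form into which rewriting with associativity brings the
    identity.\<close>
  have V_identity': "x \<oplus>\<^bsub>R\<^esub> (y \<oplus>\<^bsub>R\<^esub> x \<otimes>\<^bsub>R\<^esub> (y \<otimes>\<^bsub>R\<^esub> z)) = x \<oplus>\<^bsub>R\<^esub> y"
    if "x \<in> carrier R" "y \<in> carrier R" "z \<in> carrier R" for x y z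
    using V_identity[OF that] that by (simp add: a_assoc m_assoc)
  show ?thesis
    by unfold_locales
      (auto simp: transport_simps[OF e] a_assoc m_assoc l_distr r_distr m_idem V_identity'
         intro!: arg_cong[of _ _ e] intro: a_comm m_comm)
qed

lemma congruence_closed: "congruence R \<psi> \<Longrightarrow> (x, y) \<in> \<psi> \<Longrightarrow> x \<in> carrier R \<and> y \<in> carrier R"
  unfolding congruence_def by (meson equiv_class_eq_iff)

lemma congruence_vimage:
  assumes R: "semiring R" and e: "inj_on e (carrier R)" and \<psi>: "congruence (transport e R) \<psi>"
  shows "congruence R {(x, y) \<in> carrier R \<times> carrier R. (e x, e y) \<in> \<psi>}"
proof -
  interpret semiring R by fact
  have eq: "equiv (e ` carrier R) \<psi>"
    and ops: "\<And>a b c d. \<lbrakk>(a, b) \<in> \<psi>; (c, d) \<in> \<psi>\<rbrakk> \<Longrightarrow>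
      (a \<oplus>\<^bsub>transport e R\<^esub> c, b \<oplus>\<^bsub>transport e R\<^esub> d) \<in> \<psi> \<and>
      (a \<otimes>\<^bsub>transport e R\<^esub> c, b \<otimes>\<^bsub>transport e R\<^esub> d) \<in> \<psi>"
    using \<psi> by (simp_all add: congruence_def transport_simps[OF e])
  have "equiv (carrier R) {(x, y) \<in> carrier R \<times> carrier R. (e x, e y) \<in> \<psi>}"
  proof (rule equivI)
    show "refl_on (carrier R) {(x, y) \<in> carrier R \<times> carrier R. (e x, e y) \<in> \<psi>}"
      using eq by (auto simp: equiv_def refl_on_def)
    show "sym {(x, y) \<in> carrier R \<times> carrier R. (e x, e y) \<in> \<psi>}"
      using eq by (auto simp: equiv_def sym_def)
    show "trans {(x, y) \<in> carrier R \<times> carrier R. (e x, e y) \<in> \<psi>}"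
      using eq unfolding equiv_def trans_def by blast
  qed auto
  then show ?thesis
    unfolding congruence_def using ops by (fastforce simp flip: transport_simps(4,5)[OF e])
qed

lemma congruence_image:
  assumes e: "inj_on e (carrier R)" and \<theta>: "congruence R \<theta>"
  shows "congruence (transport e R) (map_prod e e ` \<theta>)"
proof -
  have eq: "equiv (carrier R) \<theta>"
    and ops: "\<And>a b c d. \<lbrakk>(a, b) \<in> \<theta>; (c, d) \<in> \<theta>\<rbrakk> \<Longrightarrow>
      (a \<oplus>\<^bsub>R\<^esub> c, b \<oplus>\<^bsub>R\<^esub> d) \<in> \<theta> \<and> (a \<otimes>\<^bsub>R\<^esub> c, b \<otimes>\<^bsub>R\<^esub> d) \<in> \<theta>"
    using \<theta> by (simp_all add: congruence_def)
  note car = congruence_closed[OF \<theta>]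
  have "equiv (e ` carrier R) (map_prod e e ` \<theta>)"
  proof (rule equivI)
    show "map_prod e e ` \<theta> \<subseteq> e ` carrier R \<times> e ` carrier R"
      using car by fastforce
    show "refl_on (e ` carrier R) (map_prod e e ` \<theta>)"
      using eq by (force simp: equiv_def refl_on_def)
    show "sym (map_prod e e ` \<theta>)"
      using eq by (force simp: equiv_def sym_def)
    show "trans (map_prod e e ` \<theta>)"
    proof (rule transI)
      fix x y z assume "(x, y) \<in> map_prod e e ` \<theta>" "(y, z) \<in> map_prod e e ` \<theta>"
      then obtain a b c d where abcd: "(a, b) \<in> \<theta>" "(c, d) \<in> \<theta>" "x = e a" "y = e b" "y = e c" "z = e d"
        by auto
      then have "b = c" using car e by (metis inj_onD)
      then have "(a, d) \<in> \<theta>" using abcd eq by (meson equivE transD)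
      then show "(x, z) \<in> map_prod e e ` \<theta>" using abcd by force
    qed
  qed
  moreover have "(a \<oplus>\<^bsub>transport e R\<^esub> c, b \<oplus>\<^bsub>transport e R\<^esub> d) \<in> map_prod e e ` \<theta> \<and>
      (a \<otimes>\<^bsub>transport e R\<^esub> c, b \<otimes>\<^bsub>transport e R\<^esub> d) \<in> map_prod e e ` \<theta>"
    if "(a, b) \<in> map_prod e e ` \<theta>" "(c, d) \<in> map_prod e e ` \<theta>" for a b c d
  proof -
    from that obtain a' b' c' d' where "(a', b') \<in> \<theta>" "(c', d') \<in> \<theta>"
      and [simp]: "a = e a'" "b = e b'" "c = e c'" "d = e d'" by auto
    with ops[of a' b' c' d'] car[of a' b'] car[of c' d'] show ?thesis
      by (auto simp: transport_simps[OF e] intro!: image_eqI[of _ "map_prod e e" "(_, _)"])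
  qed
  ultimately show ?thesis
    by (simp add: congruence_def transport_simps[OF e])
qed

text \<open>A nontrivial congruence of the copy pulls back along \<open>e\<close> to a nontrivial
  congruence of \<open>R\<close>. The latter contains \<theta>, so the former contains the image of
  \<theta>.\<close>

lemma monolith_transport:
  assumes R: "semiring R" and e: "inj_on e (carrier R)" and \<theta>: "monolith R \<theta>"
  shows "monolith (transport e R) (map_prod e e ` \<theta>)"
  unfolding monolith_def
proof (intro conjI allI impI)
  have \<theta>': "congruence R \<theta>" "\<theta> \<noteq> Id_on (carrier R)"
    "\<And>\<psi>. \<lbrakk>congruence R \<psi>; \<psi> \<noteq> Id_on (carrier R)\<rbrakk> \<Longrightarrow> \<theta> \<subseteq> \<psi>"
    using \<theta> by (simp_all add: monolith_def)
  show "congruence (transport e R) (map_prod e e ` \<theta>)"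
    by (rule congruence_image[OF e \<theta>'(1)])
  have nontriv: "\<exists>(x, y)\<in>\<psi>. x \<noteq> y" if "congruence S \<psi>" "\<psi> \<noteq> Id_on (carrier S)" for S :: "'c ring" and \<psi>
  proof (rule ccontr)
    assume "\<not> ?thesis"
    moreover have "(x, x) \<in> \<psi>" if "x \<in> carrier S" for x
      using \<open>congruence S \<psi>\<close> that by (simp add: congruence_def equiv_def refl_on_def)
    ultimately have "\<psi> = Id_on (carrier S)"
      using congruence_closed[OF that(1)] by auto
    with that(2) show False ..
  qed
  obtain x y where "(x, y) \<in> \<theta>" "x \<noteq> y"
    using nontriv[OF \<theta>'(1,2)] by blast
  then have "(e x, e y) \<in> map_prod e e ` \<theta>" "e x \<noteq> e y"
    using congruence_closed[OF \<theta>'(1)] e by (auto simp: inj_on_def)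
  then show "map_prod e e ` \<theta> \<noteq> Id_on (carrier (transport e R))"
    by (metis Id_onE Pair_inject)
  fix \<psi> assume \<psi>: "congruence (transport e R) \<psi>" "\<psi> \<noteq> Id_on (carrier (transport e R))"
  define \<phi> where "\<phi> = {(x, y) \<in> carrier R \<times> carrier R. (e x, e y) \<in> \<psi>}"
  obtain x y where "(x, y) \<in> \<psi>" "x \<noteq> y"
    using nontriv[OF \<psi>] by blast
  then obtain a b where "a \<in> carrier R" "b \<in> carrier R" "x = e a" "y = e b"
    using congruence_closed[OF \<psi>(1)] unfolding transport_simps(1)[OF e] by blast
  with \<open>(x, y) \<in> \<psi>\<close> \<open>x \<noteq> y\<close> have "(a, b) \<in> \<phi>" "a \<noteq> b"
    by (auto simp: \<phi>_def)
  then have "\<phi> \<noteq> Id_on (carrier R)"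
    by (metis Id_onE Pair_inject)
  then have "\<theta> \<subseteq> \<phi>"
    using congruence_vimage[OF R e \<psi>(1)] \<theta>'(3) by (simp add: \<phi>_def)
  then show "map_prod e e ` \<theta> \<subseteq> \<psi>"
    by (auto simp: \<phi>_def)
qed

text \<open>In \<open>unit_ring X\<close> the new unit is \<open>None\<close>; its monolith is the kernel of the homomorphism
  \<open>drop_unit X\<close>, which sends \<open>c\<close> to \<open>c + c\<close>.\<close>

definition finset_lattice :: "'x set \<Rightarrow> 'x set set" where
  "finset_lattice X = insert X {A. A \<subseteq> X \<and> finite A}"

fun unit_add :: "'x set \<Rightarrow> 'x set option \<Rightarrow> 'x set option \<Rightarrow> 'x set option" where
  "unit_add X (Some A) (Some B) = Some (A \<union> B)"
| "unit_add X None c = (if c = Some {} then None else Some X)"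
| "unit_add X c None = (if c = Some {} then None else Some X)"

fun unit_mult :: "'x set option \<Rightarrow> 'x set option \<Rightarrow> 'x set option" where
  "unit_mult (Some A) (Some B) = Some (A \<inter> B)"
| "unit_mult None c = c"
| "unit_mult c None = c"

definition unit_ring :: "'x set \<Rightarrow> 'x set option ring" where
  "unit_ring X = \<lparr> carrier = insert None (Some ` finset_lattice X), mult = unit_mult, one = None,
     zero = Some {}, add = unit_add X \<rparr>"

lemma unit_ring_simps [simp]:
  "carrier (unit_ring X) = insert None (Some ` finset_lattice X)"
  "x \<otimes>\<^bsub>unit_ring X\<^esub> y = unit_mult x y" "\<one>\<^bsub>unit_ring X\<^esub> = None"
  "\<zero>\<^bsub>unit_ring X\<^esub> = Some {}" "x \<oplus>\<^bsub>unit_ring X\<^esub> y = unit_add X x y"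
  by (simp_all add: unit_ring_def)

lemma finset_lattice_simps [simp]:
  "X \<in> finset_lattice X" "{} \<in> finset_lattice X"
  "\<lbrakk>A \<in> finset_lattice X; B \<in> finset_lattice X\<rbrakk> \<Longrightarrow> A \<union> B \<in> finset_lattice X"
  "\<lbrakk>A \<in> finset_lattice X; B \<in> finset_lattice X\<rbrakk> \<Longrightarrow> A \<inter> B \<in> finset_lattice X"
  "x \<in> X \<Longrightarrow> {x} \<in> finset_lattice X"
  by (auto simp: finset_lattice_def Un_absorb1 Un_absorb2 Int_absorb1 Int_absorb2)

lemma finset_lattice_subset: "A \<in> finset_lattice X \<Longrightarrow> A \<subseteq> X"
  by (auto simp: finset_lattice_def)

lemma unit_mult_None [simp]: "unit_mult c None = c"
  by (cases c) auto

lemma unit_add_None [simp]: "unit_add X c None = (if c = Some {} then None else Some X)"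
  by (cases c) auto

text \<open>Distributivity at the unit holds because c(1 + a) = c = c + ca for nonzero a in the
  lattice. X must be nonempty: otherwise 1 + 1 = 0, and the identity fails at x = y = z = 1.\<close>

lemma V_semiring_unit_ring:
  assumes "X \<noteq> {}"
  shows "V_semiring (unit_ring X)"
proof -
  let ?C = "insert None (Some ` finset_lattice X)"
  have comm: "unit_add X a b = unit_add X b a" "unit_mult a b = unit_mult b a" for a b
    by (cases a; cases b; auto)+
  have closed: "unit_add X a b \<in> ?C" "unit_mult a b \<in> ?C" if "a \<in> ?C" "b \<in> ?C" for a b
    using that by (cases a; cases b; simp add: inj_image_mem_iff)+
  have assoc: "unit_add X (unit_add X a b) c = unit_add X a (unit_add X b c)"
    and distr: "unit_mult c (unit_add X a b) = unit_add X (unit_mult c a) (unit_mult c b)"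
    and V: "unit_add X (unit_add X a b) (unit_mult (unit_mult a b) c) = unit_add X a b"
    if abc: "a \<in> ?C" "b \<in> ?C" "c \<in> ?C" for a b c
  proof -
    have sub: "\<forall>A\<in>set_option a. A \<subseteq> X" "\<forall>A\<in>set_option b. A \<subseteq> X" "\<forall>A\<in>set_option c. A \<subseteq> X"
      using abc finset_lattice_subset by auto
    show "unit_add X (unit_add X a b) c = unit_add X a (unit_add X b c)"
      using sub assms by (cases a; cases b; cases c) auto
    show "unit_mult c (unit_add X a b) = unit_add X (unit_mult c a) (unit_mult c b)"
      using sub by (cases a; cases b; cases c) auto
    show "unit_add X (unit_add X a b) (unit_mult (unit_mult a b) c) = unit_add X a b"
      using sub assms by (cases a; cases b; cases c) auto
  qed
  have zero: "unit_add X (Some {}) a = a" "unit_mult (Some {}) a = Some {}" for a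
    by (cases a; simp)+
  have massoc: "unit_mult (unit_mult a b) c = unit_mult a (unit_mult b c)" for a b c
    by (cases a; cases b; cases c) auto
  have idem: "unit_mult a a = a" for a
    by (cases a) auto
  have distr': "unit_mult (unit_add X a b) c = unit_add X (unit_mult a c) (unit_mult b c)"
    if "a \<in> ?C" "b \<in> ?C" "c \<in> ?C" for a b c
    using distr[OF that] by (simp only: comm)
  have units: "None \<in> ?C" "Some {} \<in> ?C" "unit_mult None a = a" "unit_mult a None = a"
    "unit_add X a (Some {}) = a" "unit_mult a (Some {}) = Some {}" for a
    using zero by (simp_all add: comm[of a])
  show ?thesis
    by unfold_locales (unfold unit_ring_simps monoid.simps partial_object.simps,
      (assumption | rule closed assoc distr distr' V zero units massoc idem comm)+)
qed

definition drop_unit :: "'x set \<Rightarrow> 'x set option \<Rightarrow> 'x set" where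
  "drop_unit X a = (case a of None \<Rightarrow> X | Some A \<Rightarrow> A)"

lemma drop_unit_simps [simp]: "drop_unit X None = X" "drop_unit X (Some A) = A"
  by (simp_all add: drop_unit_def)

text \<open>The only distinct elements with the same \<open>drop_unit\<close> are
  \<open>None\<close> and \<open>Some X\<close>, so every nontrivial congruence has to be shown to
  contain this pair. Any other pair of distinct elements is turned into it by a meet with a suitable
  singleton, if needed, and the addition of the unit.\<close>

lemma monolith_unit_ring:
  assumes "X \<noteq> {}"
  shows "monolith (unit_ring X)
    {(a, b). a \<in> carrier (unit_ring X) \<and> b \<in> carrier (unit_ring X) \<and> drop_unit X a = drop_unit X b}"
    (is "monolith ?R ?\<theta>")
proof -
  let ?C = "insert None (Some ` finset_lattice X)"
  interpret V_semiring ?R by (rule V_semiring_unit_ring) fact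
  have "drop_unit X (unit_add X a b) = drop_unit X a \<union> drop_unit X b"
    and "drop_unit X (unit_mult a b) = drop_unit X a \<inter> drop_unit X b" if "a \<in> ?C" "b \<in> ?C" for a b
    using that assms by (cases a; cases b; auto dest!: finset_lattice_subset)+
  moreover have "unit_add X a b \<in> ?C" "unit_mult a b \<in> ?C" if "a \<in> ?C" "b \<in> ?C" for a b
    using that a_closed[of a b] m_closed[of a b] by simp_all
  moreover have "equiv ?C ?\<theta>"
    by (rule equivI) (auto simp: refl_on_def sym_def trans_def)
  ultimately have cong: "congruence ?R ?\<theta>"
    by (simp add: congruence_def)
  have least: "?\<theta> \<subseteq> \<psi>" if \<psi>: "congruence ?R \<psi>" and nontriv: "\<psi> \<noteq> Id_on (carrier ?R)" for \<psi>
  proof -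
    have refl: "(a, a) \<in> \<psi>" if "a \<in> ?C" for a
      using \<psi> that by (cases a) (auto simp: congruence_def equiv_def refl_on_def)
    have symm: "(b, a) \<in> \<psi>" if "(a, b) \<in> \<psi>" for a b
      using \<psi> that by (auto simp: congruence_def equiv_def sym_def)
    have add: "(unit_add X a c, unit_add X b d) \<in> \<psi>"
      and mult: "(unit_mult a c, unit_mult b d) \<in> \<psi>"
      if "(a, b) \<in> \<psi>" "(c, d) \<in> \<psi>" for a b c d
      using \<psi> that by (simp_all add: congruence_def)
    \<comment> \<open>Adding \<open>None\<close> turns \<open>Some {}\<close> into
      \<open>None\<close> and a nonzero \<open>Some B\<close> into \<open>Some X\<close>.\<close>
    have zero: "(None, Some X) \<in> \<psi>" if "(Some {}, Some B) \<in> \<psi>" "B \<noteq> {}" for B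
      using add[OF that(1) refl[of None]] that(2) by simp
    have diff: "(None, Some X) \<in> \<psi>" if AB: "(Some A, Some B) \<in> \<psi>" "x \<in> B" "x \<notin> A" for A B x
    proof -
      have "x \<in> X"
        using congruence_closed[OF \<psi> AB(1)] AB(2) finset_lattice_subset by auto
      \<comment> \<open>The meet with {x} is empty for A and {x} for B.\<close>
      then have "(Some {}, Some {x}) \<in> \<psi>"
        using mult[OF AB(1) refl[of "Some {x}"]] AB(2,3) by simp
      then show ?thesis by (rule zero) simp
    qed
    have one: "(None, Some X) \<in> \<psi>" if B: "(None, Some B) \<in> \<psi>" for B
    proof (cases "B = X")
      case False
      moreover have "B \<in> finset_lattice X"
        using congruence_closed[OF \<psi> B] by auto
      ultimately obtain x where "x \<in> X" "x \<notin> B"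
        using finset_lattice_subset by blast
      \<comment> \<open>The meet with {x} sends the unit to \<open>Some {x}\<close> and
        \<open>Some B\<close> to zero.\<close>
      then have "(Some {}, Some {x}) \<in> \<psi>"
        using symm[OF mult[OF B refl[of "Some {x}"]]] by simp
      then show ?thesis by (rule zero) simp
    qed (use B in simp)
    obtain a b where ab: "(a, b) \<in> \<psi>" "a \<noteq> b"
    proof -
      have "\<psi> = Id_on (carrier ?R)" if "\<forall>(a, b)\<in>\<psi>. a = b"
      proof
        show "\<psi> \<subseteq> Id_on (carrier ?R)"
          using that congruence_closed[OF \<psi>] by (fast intro: Id_onI)
        show "Id_on (carrier ?R) \<subseteq> \<psi>"
          using refl by auto
      qed
      with nontriv that show ?thesis by blast
    qed
    have "(None, Some X) \<in> \<psi>"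
    proof (cases a; cases b)
      fix A B assume "a = Some A" "b = Some B"
      moreover with ab obtain x where "x \<in> A - B \<or> x \<in> B - A" by blast
      ultimately show ?thesis using ab symm diff by blast
    qed (use ab one symm in auto)
    then show ?thesis using symm refl by (auto simp del: insert_iff) auto
  qed
  have "(None, Some X) \<in> ?\<theta>" "(None, Some X) \<notin> Id_on (carrier ?R)"
    by auto
  then have "?\<theta> \<noteq> Id_on (carrier ?R)" by blast
  with cong least show ?thesis by (simp only: monolith_def) blast
qed

text \<open>Reduces the existence of a subdirectly irreducible member on a given set to counting the
  elements of \<open>unit_ring X\<close>.\<close>

lemma subdirectly_irreducible_exists:
  fixes S :: "'b set" and X :: "'x set"
  assumes "X \<noteq> {}" and "bij_betw e (carrier (unit_ring X)) S"
  shows "\<exists>R :: 'b ring. V_semiring R \<and> subdirectly_irreducible R \<and> carrier R = S"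
proof (intro exI conjI)
  have inj: "inj_on e (carrier (unit_ring X))" and im: "e ` carrier (unit_ring X) = S"
    using assms(2) by (simp_all only: bij_betw_def)
  show V: "V_semiring (transport e (unit_ring X))"
    by (rule V_semiring_transport[OF V_semiring_unit_ring[OF assms(1)] inj])
  show "subdirectly_irreducible (transport e (unit_ring X))"
    using monolith_transport[OF _ inj monolith_unit_ring[OF assms(1)]] V V_semiring_unit_ring[OF assms(1)]
    unfolding V_semiring_def by (subst subdirectly_irreducible_iff_monolith) blast+
  show "carrier (transport e (unit_ring X)) = S"
    using transport_simps(1)[OF inj] im by simp
qed

section \<open>Cardinalities of the subdirectly irreducible members\<close>

lemma subdirectly_irreducible_finite:
  assumes "n \<ge> 1"
  shows "\<exists>R :: nat ring. V_semiring R \<and> subdirectly_irreducible R \<and>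
    finite (carrier R) \<and> card (carrier R) = 2 ^ n + 1"
proof -
  define X where "X = {..<n}"
  \<comment> \<open>All subsets of a finite X are finite, so the lattice has \<open>2 ^ n\<close>
    elements; the new unit is the one extra element.\<close>
  have "finset_lattice X = Pow X"
    using finite_subset[of _ X] by (auto simp: finset_lattice_def X_def)
  then have C: "carrier (unit_ring X) = insert None (Some ` Pow X)"
    by simp
  have "card (Some ` Pow X) = 2 ^ n"
    by (simp add: X_def card_image card_Pow)
  then have card: "card (carrier (unit_ring X)) = 2 ^ n + 1" and fin: "finite (carrier (unit_ring X))"
    unfolding C by (simp_all add: X_def card_insert_if)
  obtain e where "bij_betw e (carrier (unit_ring X)) {0..<card (carrier (unit_ring X))}"
    using ex_bij_betw_finite_nat[OF fin] by blast
  from subdirectly_irreducible_exists[OF _ this] assms card show ?thesis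
    by (fastforce simp: X_def)
qed

lemma card_of_Un_ordLeq_infinite:
  "\<lbrakk>infinite X; |A| \<le>o |X|; |B| \<le>o |X|\<rbrakk> \<Longrightarrow> |A \<union> B| \<le>o |X|"
  by (rule card_of_Un_ordLeq_infinite_Field) (use card_of_Card_order in \<open>simp_all add: Field_card_of\<close>)

text \<open>A nonempty set with at most n + 1 elements arises from one with at most n by inserting a
  point, so by induction each \<open>F n\<close> has cardinality at most |X|. A countable union
  preserves this bound.\<close>

lemma card_of_finite_subsets:
  assumes "infinite X"
  shows "|{A. A \<subseteq> X \<and> finite A}| \<le>o |X|"
proof -
  define F where "F n = {A. A \<subseteq> X \<and> finite A \<and> card A \<le> n}" for n
  have "|F n| \<le>o |X|" for n
  proof (induction n)
    case 0
    have "F 0 = {{}}" by (auto simp: F_def)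
    then show ?case using assms by (simp add: card_of_singl_ordLeq infinite_imp_nonempty)
  next
    case (Suc n)
    have "F (Suc n) \<subseteq> insert {} ((\<lambda>(x, A). insert x A) ` (X \<times> F n))"
    proof
      fix A assume A: "A \<in> F (Suc n)"
      show "A \<in> insert {} ((\<lambda>(x, A). insert x A) ` (X \<times> F n))"
      proof (cases "A = {}")
        case False
        then obtain x where "x \<in> A" by blast
        with A have "A = (\<lambda>(x, A). insert x A) (x, A - {x})" "(x, A - {x}) \<in> X \<times> F n"
          by (auto simp: F_def card_Diff_singleton)
        then show ?thesis by blast
      qed simp
    qed
    \<comment> \<open>A product of X with a nonempty set of no larger cardinality is equinumerous
      with X.\<close>
    moreover have "F n \<noteq> {}" by (auto simp: F_def intro!: exI[of _ "{}"])
    then have "|X \<times> F n| =o |X|"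
      using card_of_Times_infinite[OF assms _ Suc] by blast
    then have "|(\<lambda>(x, A). insert x A) ` (X \<times> F n)| \<le>o |X|"
      using card_of_image ordLeq_ordIso_trans by blast
    then have "|{{}} \<union> (\<lambda>(x, A). insert x A) ` (X \<times> F n)| \<le>o |X|"
      using assms by (intro card_of_Un_ordLeq_infinite) (simp_all add: card_of_singl_ordLeq infinite_imp_nonempty)
    ultimately show ?case
      using ordLeq_transitive[OF card_of_mono1] by simp
  qed
  moreover have "|UNIV :: nat set| \<le>o |X|"
    using assms infinite_iff_card_of_nat by blast
  ultimately have "|\<Union>n. F n| \<le>o |X|"
    using assms by (intro card_of_UNION_ordLeq_infinite) auto
  moreover have "{A. A \<subseteq> X \<and> finite A} = (\<Union>n. F n)"
    by (auto simp: F_def)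
  ultimately show ?thesis by simp
qed

lemma card_of_unit_ring:
  assumes "infinite X"
  shows "|carrier (unit_ring X)| =o |X|"
proof -
  have one: "|{x}| \<le>o |X|" for x :: 'c
    using assms by (simp add: card_of_singl_ordLeq infinite_imp_nonempty)
  have "finset_lattice X = {X} \<union> {A. A \<subseteq> X \<and> finite A}"
    by (simp add: finset_lattice_def)
  moreover have "|{X} \<union> {A. A \<subseteq> X \<and> finite A}| \<le>o |X|"
    by (rule card_of_Un_ordLeq_infinite[OF assms one card_of_finite_subsets[OF assms]])
  ultimately have "|Some ` finset_lattice X| \<le>o |X|"
    by (simp only: ordLeq_transitive[OF card_of_image])
  then have "|{None} \<union> Some ` finset_lattice X| \<le>o |X|"
    by (rule card_of_Un_ordLeq_infinite[OF assms one])
  moreover have "inj_on (\<lambda>x. Some {x}) X" "(\<lambda>x. Some {x}) ` X \<subseteq> carrier (unit_ring X)"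
    by (auto simp: inj_on_def)
  then have "|X| \<le>o |carrier (unit_ring X)|"
    using card_of_ordLeq by blast
  ultimately show ?thesis
    by (simp add: ordIso_iff_ordLeq)
qed

lemma subdirectly_irreducible_infinite:
  fixes X :: "'x set"
  assumes "infinite X"
  shows "\<exists>R :: 'x ring. V_semiring R \<and> subdirectly_irreducible R \<and> carrier R = X"
proof -
  obtain e where "bij_betw e (carrier (unit_ring X)) X"
    using card_of_unit_ring[OF assms] card_of_ordIso by blast
  with assms show ?thesis
    by (intro subdirectly_irreducible_exists) auto
qed

text \<open>Some subdirectly irreducible member has the whole type \<open>('k + nat) set\<close> as
  carrier. By Cantor's theorem this exceeds every cardinal on \<open>'k\<close>; the summand
  \<open>nat\<close> makes the type infinite even if \<open>'k\<close> is finite.\<close>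

lemma residually_big:
  "\<nexists>k :: 'k rel. Card_order k \<and>
     (\<forall>R :: ('k + nat) set ring. V_semiring R \<longrightarrow> subdirectly_irreducible R \<longrightarrow> |carrier R| \<le>o k)"
proof
  assume "\<exists>k :: 'k rel. Card_order k \<and>
     (\<forall>R :: ('k + nat) set ring. V_semiring R \<longrightarrow> subdirectly_irreducible R \<longrightarrow> |carrier R| \<le>o k)"
  then obtain k :: "'k rel" where k: "Card_order k"
    and bound: "\<And>R :: ('k + nat) set ring. V_semiring R \<Longrightarrow> subdirectly_irreducible R \<Longrightarrow>
      |carrier R| \<le>o k" by blast
  have inf: "infinite (UNIV :: ('k + nat) set set)"
    by (simp add: Finite_Set.finite_set)
  obtain R :: "('k + nat) set ring" where "V_semiring R" "subdirectly_irreducible R" "carrier R = UNIV"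
    using subdirectly_irreducible_infinite[OF inf] by blast
  with bound have "|UNIV :: ('k + nat) set set| \<le>o k" by metis
  moreover have "k \<le>o |UNIV :: 'k set|"
    using card_of_Field_ordIso[OF k] card_of_mono1[of "Field k" UNIV]
    by (meson ordIso_ordLeq_trans ordIso_symmetric subset_UNIV)
  moreover have "|UNIV :: 'k set| \<le>o |UNIV :: ('k + nat) set|"
    using card_of_Plus1[of "UNIV :: 'k set" "UNIV :: nat set"] by simp
  moreover have "|UNIV :: ('k + nat) set| <o |UNIV :: ('k + nat) set set|"
    using card_of_Pow[of "UNIV :: ('k + nat) set"] by simp
  ultimately show False
    by (meson not_ordLess_ordLeq ordLeq_transitive)
qed

theorem corollary4p3:
  shows
    "(\<forall>R :: 'a ring. V_semiring R \<longrightarrow> finitely_generated R \<longrightarrow> finite (carrier R))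
     \<and> (\<forall>n \<ge> 1. \<exists>R :: nat ring. V_semiring R \<and> subdirectly_irreducible R \<and>
           finite (carrier R) \<and> card (carrier R) = 2 ^ n + 1)
     \<and> (\<forall>k :: 'k rel. Card_order k \<and> infinite (Field k) \<longrightarrow>
           (\<exists>R :: 'k ring. V_semiring R \<and> subdirectly_irreducible R \<and> |carrier R| =o k))
     \<and> (\<nexists>k :: 'k rel. Card_order k \<and>
           (\<forall>R :: ('k + nat) set ring. V_semiring R \<longrightarrow> subdirectly_irreducible R \<longrightarrow>
              |carrier R| \<le>o k))
     \<and> (\<forall>n t. vars t \<subseteq> {1..n} \<longrightarrow>
           (\<exists>!Is. reduced_rep n Is \<and> V_models t (rep_term Is)))
     \<and> algorithmically_decidable V_models"
proof (intro conjI)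
  show "\<forall>R :: 'a ring. V_semiring R \<longrightarrow> finitely_generated R \<longrightarrow> finite (carrier R)"
    using locally_finite by blast
  show "\<forall>n\<ge>1. \<exists>R :: nat ring. V_semiring R \<and> subdirectly_irreducible R \<and>
      finite (carrier R) \<and> card (carrier R) = 2 ^ n + 1"
    using subdirectly_irreducible_finite by blast
  show "\<forall>k :: 'k rel. Card_order k \<and> infinite (Field k) \<longrightarrow>
      (\<exists>R :: 'k ring. V_semiring R \<and> subdirectly_irreducible R \<and> |carrier R| =o k)"
    using subdirectly_irreducible_infinite card_of_Field_ordIso by metis
  show "\<nexists>k :: 'k rel. Card_order k \<and>
      (\<forall>R :: ('k + nat) set ring. V_semiring R \<longrightarrow> subdirectly_irreducible R \<longrightarrow>
         |carrier R| \<le>o k)"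
    by (rule residually_big)
  show "\<forall>n t. vars t \<subseteq> {1..n} \<longrightarrow> (\<exists>!Is. reduced_rep n Is \<and> V_models t (rep_term Is))"
    using normal_form by blast
  show "algorithmically_decidable V_models"
    by (rule V_models_decidable)
qed

end
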